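(* Let $0<\lambda\le2$. If $f(z)=z+\sum_{n=2}^\infty a_nz^n$ belongs to $\overline{\mathrm{co}(C)}$, then $$|\lambda a_n^2-a_{2n-1}|\le1\qquad\text{for all } n\ge2 .$$ For any fixed $n\ge 2$ and $\lambda<2$, equality holds only for the functions of the following form (and for their rotations): $$f(z)=\sum_{k=1}^{2n-2}m_k\frac{z}{1-e^{i\theta_k}z},$$ where $0\le m_k\le1$, $\theta_k=\frac{(2k+1)\pi}{2n-2}$, and $$\sum_{k=1}^{n-1}m_{2k}=\sum_{k=1}^{n-1}m_{2k-1}=\frac12 .$$
   Context: $\mathbb{D}=\{z\in\mathbb{C}:|z|<1\}$ is the open unit disk. $S$ is the class of all univalent (that is, analytic and one-to-one) functions $f$ in $\mathbb{D}$ with Taylor series $f(z)=z+\sum_{n=2}^\infty a_nz^n$. $C$ is the class of convex functions in $S$, i.e. those $f\in S$ for which $f(\mathbb{D})$ is a convex set. $\mathrm{co}(C)$ is the convex hull of $C$ and $\overline{\mathrm{co}(C)}$ is its closure in the topology of uniform convergence on compact subsets of $\mathbb{D}$. A rotation of a function $f$ is a function of the form $f_c(z)=\overline{c}f(cz)$ with $c\in\mathbb{C}$, $|c|=1$. *)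

theory Defs
  imports "HOL-Complex_Analysis.Complex_Analysis" "HOL-Library.Function_Algebras"
begin

text \<open>
  With the pointwise vector space structure on functions, the library's \<^term>\<open>convex hull F\<close>
  is the usual convex hull of a family \<^term>\<open>F\<close> of functions.
\<close>

instantiation "fun" :: (type, real_vector) real_vector
begin

definition scaleR_fun :: "real \<Rightarrow> ('a \<Rightarrow> 'b) \<Rightarrow> 'a \<Rightarrow> 'b" where
  "scaleR_fun r f = (\<lambda>x. r *\<^sub>R f x)"

instance
  by standard (auto simp: scaleR_fun_def fun_eq_iff scaleR_add_right scaleR_add_left)

end

text \<open>
  Functions on the unit disk are represented by total functions on the complex plane; the values
  outside of the disk are arbitrary and play no role in what follows.
\<close>

definition class_S :: "(complex \<Rightarrow> complex) set" where
  "class_S = {f. f holomorphic_on ball 0 1 \<and> inj_on f (ball 0 1) \<and> f 0 = 0 \<and> deriv f 0 = 1}"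

definition class_C :: "(complex \<Rightarrow> complex) set" where
  "class_C = {f \<in> class_S. convex (f ` ball 0 1)}"

text \<open>
  The topology of uniform convergence on compact subsets of \<^term>\<open>D\<close>, on the space of
  holomorphic functions on \<^term>\<open>D\<close>. Functions that agree on \<^term>\<open>D\<close> have
  the same neighbourhoods.
\<close>

definition compact_convergence :: "complex set \<Rightarrow> (complex \<Rightarrow> complex) topology" where
  "compact_convergence D = topology (\<lambda>U. U \<subseteq> {f. f holomorphic_on D} \<and>
     (\<forall>f\<in>U. \<exists>K \<epsilon>. compact K \<and> K \<subseteq> D \<and> \<epsilon> > 0 \<and>
        {g. g holomorphic_on D \<and> (\<forall>z\<in>K. dist (g z) (f z) < \<epsilon>)} \<subseteq> U))"

lemma openin_compact_convergence:
  "openin (compact_convergence D) U \<longleftrightarrow> U \<subseteq> {f. f holomorphic_on D} \<and>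
     (\<forall>f\<in>U. \<exists>K \<epsilon>. compact K \<and> K \<subseteq> D \<and> \<epsilon> > 0 \<and>
        {g. g holomorphic_on D \<and> (\<forall>z\<in>K. dist (g z) (f z) < \<epsilon>)} \<subseteq> U)"
proof -
  define N where "N f K \<epsilon> = {g. g holomorphic_on D \<and> (\<forall>z\<in>K. dist (g z) (f z) < \<epsilon>)}"
    for f K and \<epsilon> :: real
  define P where "P U \<longleftrightarrow> U \<subseteq> {f. f holomorphic_on D} \<and>
     (\<forall>f\<in>U. \<exists>K \<epsilon>. compact K \<and> K \<subseteq> D \<and> \<epsilon> > 0 \<and> N f K \<epsilon> \<subseteq> U)" for U
  have "P (U \<inter> V)" if U: "P U" and V: "P V" for U V
    unfolding P_def
  proof (intro conjI ballI)
    show "U \<inter> V \<subseteq> {f. f holomorphic_on D}"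
      using U by (auto simp: P_def)
  next
    fix f assume f: "f \<in> U \<inter> V"
    obtain K \<epsilon> where K: "compact K" "K \<subseteq> D" "\<epsilon> > 0" "N f K \<epsilon> \<subseteq> U"
      using U f unfolding P_def by blast
    obtain L \<delta> where L: "compact L" "L \<subseteq> D" "\<delta> > 0" "N f L \<delta> \<subseteq> V"
      using V f unfolding P_def by blast
    have "N f (K \<union> L) (min \<epsilon> \<delta>) \<subseteq> N f K \<epsilon> \<inter> N f L \<delta>"
      by (auto simp: N_def)
    with K L show "\<exists>K \<epsilon>. compact K \<and> K \<subseteq> D \<and> \<epsilon> > 0 \<and> N f K \<epsilon> \<subseteq> U \<inter> V"
      by (intro exI[of _ "K \<union> L"] exI[of _ "min \<epsilon> \<delta>"]) auto
  qed
  moreover have "P (\<Union>\<K>)" if "\<forall>U\<in>\<K>. P U" for \<K>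
    unfolding P_def
  proof (intro conjI ballI)
    show "\<Union>\<K> \<subseteq> {f. f holomorphic_on D}"
      using that unfolding P_def by blast
  next
    fix f assume "f \<in> \<Union>\<K>"
    then obtain U where U: "U \<in> \<K>" "f \<in> U" by blast
    then have "P U" using that by simp
    then obtain K \<epsilon> where K: "compact K" "K \<subseteq> D" "\<epsilon> > 0" "N f K \<epsilon> \<subseteq> U"
      using U(2) unfolding P_def by blast
    have "N f K \<epsilon> \<subseteq> \<Union>\<K>" by (rule order_trans[OF K(4) Union_upper[OF U(1)]])
    with K show "\<exists>K \<epsilon>. compact K \<and> K \<subseteq> D \<and> \<epsilon> > 0 \<and> N f K \<epsilon> \<subseteq> \<Union>\<K>"
      by (intro exI[of _ K] exI[of _ \<epsilon>]) simp
  qed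
  ultimately have "istopology P"
    unfolding istopology_def by simp
  then show ?thesis
    unfolding compact_convergence_def P_def[abs_def] N_def[abs_def]
    by (simp add: topology_inverse')
qed

lemma topspace_compact_convergence [simp]:
  "topspace (compact_convergence D) = {f. f holomorphic_on D}"
proof
  show "topspace (compact_convergence D) \<subseteq> {f. f holomorphic_on D}"
    using openin_topspace[of "compact_convergence D"]
    unfolding openin_compact_convergence by blast
  have "openin (compact_convergence D) {f. f holomorphic_on D}"
    unfolding openin_compact_convergence
    by (auto intro!: exI[of _ "{}"] exI[of _ "1::real"])
  then show "{f. f holomorphic_on D} \<subseteq> topspace (compact_convergence D)"
    by (rule openin_subset)
qed

lemma openin_compact_convergence_nhd:
  assumes K: "compact K" "K \<subseteq> D" and f: "f holomorphic_on D"
  shows "openin (compact_convergence D)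
           {g. g holomorphic_on D \<and> (\<forall>z\<in>K. dist (g z) (f z) < \<epsilon>)}"
  unfolding openin_compact_convergence
proof (intro conjI ballI)
  fix g assume "g \<in> {g. g holomorphic_on D \<and> (\<forall>z\<in>K. dist (g z) (f z) < \<epsilon>)}"
  then have g: "g holomorphic_on D" "\<And>z. z \<in> K \<Longrightarrow> dist (g z) (f z) < \<epsilon>" by auto
  have "\<exists>\<delta>>0. \<forall>z\<in>K. dist (g z) (f z) + \<delta> \<le> \<epsilon>"
  proof (cases "K = {}")
    case True
    then show ?thesis by (auto intro: exI[of _ "1::real"])
  next
    case False
    have "continuous_on K (\<lambda>z. dist (g z) (f z))"
      using f g K(2)
      by (intro continuous_on_dist) (meson holomorphic_on_imp_continuous_on holomorphic_on_subset)+
    then obtain w where "w \<in> K" "\<forall>z\<in>K. dist (g z) (f z) \<le> dist (g w) (f w)"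
      using continuous_attains_sup[OF K(1) False] by blast
    then show ?thesis
      using g(2)[of w] by (intro exI[of _ "\<epsilon> - dist (g w) (f w)"]) auto
  qed
  then obtain \<delta> where \<delta>: "\<delta> > 0" "\<And>z. z \<in> K \<Longrightarrow> dist (g z) (f z) + \<delta> \<le> \<epsilon>"
    by blast
  have "dist (h z) (f z) < \<epsilon>" if "z \<in> K" "dist (h z) (g z) < \<delta>" for h z
    using \<delta>(2)[OF that(1)] that(2) dist_triangle[of "h z" "f z" "g z"] by linarith
  then show "\<exists>L \<delta>. compact L \<and> L \<subseteq> D \<and> \<delta> > 0 \<and>
      {h. h holomorphic_on D \<and> (\<forall>z\<in>L. dist (h z) (g z) < \<delta>)}
        \<subseteq> {h. h holomorphic_on D \<and> (\<forall>z\<in>K. dist (h z) (f z) < \<epsilon>)}"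
    using K \<delta>(1) by (intro exI[of _ K] exI[of _ \<delta>]) auto
qed auto

lemma in_closure_of_compact_convergence:
  "f \<in> compact_convergence D closure_of F \<longleftrightarrow> f holomorphic_on D \<and>
     (\<forall>K \<epsilon>. compact K \<and> K \<subseteq> D \<and> \<epsilon> > 0 \<longrightarrow>
        (\<exists>g\<in>F. g holomorphic_on D \<and> (\<forall>z\<in>K. dist (g z) (f z) < \<epsilon>)))"
  (is "?lhs \<longleftrightarrow> ?rhs")
proof
  assume L: ?lhs
  then have f: "f holomorphic_on D" by (simp add: in_closure_of)
  have "\<exists>g\<in>F. g holomorphic_on D \<and> (\<forall>z\<in>K. dist (g z) (f z) < \<epsilon>)"
    if "compact K" "K \<subseteq> D" "\<epsilon> > 0" for K \<epsilon>
  proof -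
    define T where "T = {g. g holomorphic_on D \<and> (\<forall>z\<in>K. dist (g z) (f z) < \<epsilon>)}"
    have "openin (compact_convergence D) T"
      unfolding T_def using that(1,2) f by (rule openin_compact_convergence_nhd)
    moreover have "f \<in> T" using f that(3) by (simp add: T_def)
    ultimately have "\<exists>g. g \<in> F \<and> g \<in> T" using L by (simp add: in_closure_of)
    then show ?thesis by (auto simp: T_def)
  qed
  with f show ?rhs by blast
next
  assume R: ?rhs
  show ?lhs
    unfolding in_closure_of
  proof (intro conjI allI impI)
    show "f \<in> topspace (compact_convergence D)" using R by simp
  next
    fix T assume T: "f \<in> T \<and> openin (compact_convergence D) T"
    then obtain K \<epsilon> where K: "compact K" "K \<subseteq> D" "\<epsilon> > 0"
      and KT: "{g. g holomorphic_on D \<and> (\<forall>z\<in>K. dist (g z) (f z) < \<epsilon>)} \<subseteq> T"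
      unfolding openin_compact_convergence by blast
    have "\<exists>g\<in>F. g holomorphic_on D \<and> (\<forall>z\<in>K. dist (g z) (f z) < \<epsilon>)"
      using R K by simp
    with KT show "\<exists>y. y \<in> F \<and> y \<in> T" by blast
  qed
qed

definition rotation :: "complex \<Rightarrow> (complex \<Rightarrow> complex) \<Rightarrow> complex \<Rightarrow> complex" where
  "rotation c f = (\<lambda>z. cnj c * f (c * z))"

definition extremal_angle :: "nat \<Rightarrow> nat \<Rightarrow> real" where
  "extremal_angle n k = (2 * real k + 1) * pi / (2 * real n - 2)"

definition extremal_functions :: "nat \<Rightarrow> (complex \<Rightarrow> complex) set" where
  "extremal_functions n =
     {(\<lambda>z. \<Sum>k=1..2*n-2.
          complex_of_real (m k) * (z / (1 - exp (\<i> * extremal_angle n k) * z))) | m.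
        (\<forall>k\<in>{1..2*n-2}. 0 \<le> m k \<and> m k \<le> 1) \<and>
        (\<Sum>k=1..n-1. m (2*k)) = 1/2 \<and> (\<Sum>k=1..n-1. m (2*k-1)) = (1/2::real)}"

end

theory Submission
  imports Defs
begin

text \<open>
  Put \<open>F z = f z / z = (\<Sum>k. c k * z ^ k)\<close>, so that \<open>a n = c (n - 1)\<close>. The only information needed
  about the closed convex hull is the half-plane bound \<open>Re (F z) \<ge> 1/2\<close>: it holds for convex
  functions (\<open>class_C_Re_quotient\<close>, a theorem of Marx and Strohhaecker) and, being a closed affine
  condition at each point, passes to the closed convex hull.

  By Herglotz the bound says that \<open>c k\<close> is the \<open>k\<close>-th moment of a probability measure \<open>\<mu>\<close> on the unit
  circle. What is used of \<open>\<mu>\<close> is only that \<open>\<integral> \<bar>p\<bar>\<^sup>2 d\<mu> \<ge> 0\<close> for trigonometric polynomials \<open>p\<close>, that is,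
  that the Toeplitz form of the moments is positive (\<open>Toeplitz_positive_of_Re_ge_half\<close>); no measure
  is constructed.

  With \<open>M = n - 1\<close>, \<open>b = c M\<close> and \<open>d = c (2 * M)\<close>, the moments of the push-forward of \<open>\<mu>\<close> under
  \<open>w \<mapsto> w ^ M\<close>, positivity yields \<open>\<bar>d - b\<^sup>2\<bar> = \<bar>\<integral> (w ^ M - b)\<^sup>2 d\<mu>\<bar> \<le> \<integral> \<bar>w ^ M - b\<bar>\<^sup>2 d\<mu> = 1 - \<bar>b\<bar>\<^sup>2\<close>
  (\<open>second_moment_bound\<close>). Writing \<open>\<lambda> b\<^sup>2 - d = (\<lambda> - 1) b\<^sup>2 - (d - b\<^sup>2)\<close> and using
  \<open>\<bar>\<lambda> - 1\<bar> \<le> 1\<close> gives the inequality.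

  If \<open>\<lambda> < 2\<close> then \<open>\<bar>\<lambda> - 1\<bar> < 1\<close>, so equality forces \<open>b = 0\<close> and \<open>\<bar>d\<bar> = 1\<close>. The latter means that
  \<open>w ^ (2 * M)\<close> is constant on the support of \<open>\<mu>\<close>, so \<open>\<mu>\<close> lives on the \<open>2 * M\<close> roots of
  \<open>w ^ (2 * M) = d\<close>; its masses are recovered from the moments by a discrete Fourier transform and are
  non-negative by Toeplitz positivity (\<open>equally_spaced_quadrature\<close>). On consecutive roots \<open>w ^ M\<close>
  alternates in sign, so \<open>b = 0\<close> says that the roots of even and of odd index carry mass \<open>1/2\<close> each.
  The roots form a rotation of the nodes \<open>exp (i \<theta>\<^sub>k)\<close>, which is where the rotations of \<open>f\<close> come from.
\<close>

section \<open>Schwarz and Jack lemmas\<close>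

text \<open>
  First order condition for a one-sided maximum of \<open>\<bar>\<phi>\<bar>\<close>: the left-hand side is half the derivative of
  \<open>\<bar>\<phi>\<bar>\<^sup>2\<close>. Both uses of the Schwarz lemma below extract their infinitesimal content in this way.
\<close>
lemma boundary_derivative_le:
  fixes \<phi> :: "real \<Rightarrow> complex"
  assumes der: "(\<phi> has_vector_derivative d) (at 0 within {0..1})"
    and max: "\<And>s. s \<in> {0..1} \<Longrightarrow> cmod (\<phi> s) \<le> cmod (\<phi> 0)"
  shows "Re (cnj (\<phi> 0) * d) \<le> 0"
proof -
  define N where "N s = (Re (\<phi> s))\<^sup>2 + (Im (\<phi> s))\<^sup>2" for s
  have "(N has_real_derivative 2 * Re (cnj (\<phi> 0) * d)) (at 0 within {0..1})"
    unfolding N_def by (rule derivative_eq_intros der refl)+ simp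
  then have lim: "((\<lambda>s. (N s - N 0) / (s - 0)) \<longlongrightarrow> 2 * Re (cnj (\<phi> 0) * d)) (at 0 within {0..1})"
    by (simp add: has_field_derivative_iff)
  have "N s \<le> N 0" if "s \<in> {0..1}" for s
    using power_mono[OF max[OF that] norm_ge_zero, of 2] by (simp add: N_def cmod_power2)
  then have "\<forall>\<^sub>F s in at 0 within {0..1}. (N s - N 0) / (s - 0) \<le> 0"
    by (auto simp: eventually_at_filter divide_nonpos_nonneg intro!: always_eventually)
  moreover have "at (0::real) within {0..1} \<noteq> bot"
    by (simp add: at_within_Icc_at_right)
  ultimately have "2 * Re (cnj (\<phi> 0) * d) \<le> 0"
    using tendsto_upperbound[OF lim] by blast
  then show ?thesis by linarith
qed

text \<open>
  The Schwarz lemma on a disc of radius \<open>r\<close> for a bound that may be attained: a self-map of the open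
  unit disc arises from every strictly larger bound, and the estimates pass to the limit.
\<close>
lemma Schwarz_bound:
  assumes hol: "w holomorphic_on ball 0 r" and 0: "w 0 = 0" and z: "cmod z < r"
    and bound: "\<And>z. cmod z < r \<Longrightarrow> cmod (w z) \<le> M"
  shows "cmod (w z) * r \<le> M * cmod z"
proof (cases "z = 0")
  case False
  have r: "r > 0" using z norm_ge_zero[of z] by linarith
  have "cmod (w z) * r / cmod z \<le> M'" if M': "M < M'" for M'
  proof -
    have M'0: "M' > 0"
      using bound[of 0] r 0 M' by simp
    define h where "h u = w (of_real r * u) / of_real M'" for u
    have "(\<lambda>u. w (of_real r * u)) holomorphic_on ball 0 1"
      by (rule holomorphic_on_compose_gen[of _ _ w, unfolded o_def, OF _ hol])
        (use r in \<open>auto intro!: holomorphic_intros simp: norm_mult\<close>)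
    then have "h holomorphic_on ball 0 1"
      unfolding h_def using M'0 by (intro holomorphic_intros) auto
    moreover have "cmod (h u) < 1" if "cmod u < 1" for u
      using bound[of "of_real r * u"] that r M' M'0 by (simp add: h_def norm_divide norm_mult)
    ultimately have "cmod (h (z / of_real r)) \<le> cmod (z / of_real r)"
      using r z by (intro Schwarz_Lemma) (simp_all add: 0 h_def[of 0] norm_divide)
    then show ?thesis
      using r False M'0 by (simp add: h_def norm_divide field_simps)
  qed
  then have "cmod (w z) * r / cmod z \<le> M" by (rule dense_ge)
  then show ?thesis using False by (simp add: field_simps)
qed (use 0 in simp)

text \<open>
  By the Schwarz lemma \<open>\<bar>w (z0 * exp (s * v)) / exp (s * v)\<bar>\<close> is at most \<open>\<bar>w z0\<bar>\<close> for \<open>s \<ge> 0\<close> and every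
  direction \<open>v\<close> with \<open>Re v < 0\<close>, which points into the disc, and equality holds at \<open>s = 0\<close>. With
  \<open>\<kappa> = z0 * d / w z0\<close> the derivative condition is \<open>Re ((\<kappa> - 1) * v) \<le> 0\<close>; letting \<open>v\<close> range over
  \<open>-1 + i y\<close> for all real \<open>y\<close> leaves only real \<open>\<kappa> \<ge> 1\<close>. Analyticity beyond the disc is asked for only
  at \<open>z0\<close>, because the function to which it is applied first may have poles outside.
\<close>
lemma Jack_lemma:
  assumes hol: "w holomorphic_on ball 0 (cmod z0)" and 0: "w 0 = 0"
    and der: "(w has_field_derivative d) (at z0)"
    and max: "\<And>z. cmod z < cmod z0 \<Longrightarrow> cmod (w z) \<le> cmod (w z0)"
    and nz: "w z0 \<noteq> 0"
  obtains k where "k \<ge> 1" "z0 * d = of_real k * w z0"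
proof -
  define \<kappa> where "\<kappa> = z0 * d / w z0"
  have z0: "z0 \<noteq> 0" using 0 nz by auto
  have key: "- (Re \<kappa> - 1) - y * Im \<kappa> \<le> 0" for y
  proof -
    define v where "v = Complex (- 1) y"
    define \<phi> where "\<phi> s = w (z0 * exp (of_real s * v)) * exp (- of_real s * v)" for s :: real
    have "Re (cnj (\<phi> 0) * (z0 * v * d - w z0 * v)) \<le> 0"
    proof (rule boundary_derivative_le)
      have "((\<lambda>s. w (z0 * exp (s * v)) * exp (- s * v))
          has_field_derivative (z0 * v * d - w z0 * v)) (at (of_real 0))"
        using der by (auto intro!: derivative_eq_intros DERIV_chain'[where f = "\<lambda>s. z0 * exp (s * v)" and g = w])
      then show "(\<phi> has_vector_derivative (z0 * v * d - w z0 * v)) (at 0 within {0..1})"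
        unfolding \<phi>_def by (rule has_vector_derivative_real_field)
    next
      fix s :: real assume s: "s \<in> {0..1}"
      have e: "cmod (exp (of_real s * v)) = exp (- s)" by (simp add: v_def)
      show "cmod (\<phi> s) \<le> cmod (\<phi> 0)"
      proof (cases "s = 0")
        case False
        then have "cmod (z0 * exp (of_real s * v)) < cmod z0"
          using s z0 e by (simp add: norm_mult)
        from Schwarz_bound[OF hol 0 this max] z0 e
        have "cmod (w (z0 * exp (of_real s * v))) \<le> cmod (w z0) * exp (- s)"
          by (simp add: norm_mult)
        then have "cmod (w (z0 * exp (of_real s * v))) * exp s \<le> cmod (w z0)"
          by (simp add: exp_minus field_simps)
        moreover have "cmod (exp (- of_real s * v)) = exp s" by (simp add: v_def)
        ultimately show ?thesis unfolding \<phi>_def norm_mult by simp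
      qed simp
    qed
    also have "cnj (\<phi> 0) * (z0 * v * d - w z0 * v) = of_real ((cmod (w z0))\<^sup>2) * ((\<kappa> - 1) * v)"
      unfolding complex_norm_square using nz by (simp add: \<phi>_def \<kappa>_def field_simps)
    finally have "Re ((\<kappa> - 1) * v) \<le> 0"
      using nz by (simp add: mult_le_0_iff del: of_real_power)
    then show ?thesis by (simp add: v_def algebra_simps)
  qed
  have "Im \<kappa> = 0"
  proof (rule ccontr)
    assume "Im \<kappa> \<noteq> 0"
    then show False using key[of "- (Re \<kappa>) / Im \<kappa>"] by simp
  qed
  then have "\<kappa> = of_real (Re \<kappa>)" by (simp add: complex_eq_iff)
  moreover have "Re \<kappa> \<ge> 1" using key[of 0] by simp
  moreover have "z0 * d = \<kappa> * w z0" using nz by (simp add: \<kappa>_def)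
  ultimately show ?thesis using that by metis
qed

section \<open>Convex functions and the half-plane bound\<close>
lemma deriv_nonzero_class_S:
  assumes "f \<in> class_S" "cmod z < 1"
  shows "deriv f z \<noteq> 0"
  using assms holomorphic_injective_imp_regular[of f "ball 0 1" z] by (simp add: class_S_def)

text \<open>
  This expresses that \<open>f\<close> maps the disc of radius \<open>\<bar>z0\<bar>\<close> into a half-plane with \<open>f z0\<close> on its edge. For
  \<open>t = w / z0\<close> the convex combination \<open>(1 - s) f z + s f (t z)\<close> stays in the convex image, so pulling it
  back by the inverse of \<open>f\<close> gives a self-map of the disc fixing \<open>0\<close>, to which the Schwarz lemma
  applies; at \<open>z0\<close> the modulus is maximal for \<open>s = 0\<close>, and the derivative there is the claim.
\<close>
lemma class_C_half_plane:
  assumes f: "f \<in> class_C" and w: "cmod w \<le> cmod z0" and z0: "z0 \<noteq> 0" "cmod z0 < 1"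
  shows "Re ((f z0 - f w) / (z0 * deriv f z0)) \<ge> 0"
proof -
  have hol: "f holomorphic_on ball 0 1" and inj: "inj_on f (ball 0 1)"
    and f0: "f 0 = 0" and conv: "convex (f ` ball 0 1)"
    using f by (auto simp: class_C_def class_S_def)
  obtain g where g: "g holomorphic_on f ` ball 0 1"
    "\<And>z. z \<in> ball 0 1 \<Longrightarrow> deriv f z * deriv g (f z) = 1" "\<And>z. z \<in> ball 0 1 \<Longrightarrow> g (f z) = z"
    using holomorphic_has_inverse[OF hol open_ball inj] by metis
  define t where "t = w / z0"
  have t: "cmod t \<le> 1" using w z0 by (simp add: t_def norm_divide)
  have tz: "cmod (t * z) < 1" if "cmod z < 1" for z
    using mult_left_le_one_le[of "cmod z" "cmod t"] t that by (simp add: norm_mult)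
  define p where "p s z = (1 - s) *\<^sub>R f z + s *\<^sub>R f (t * z)" for s z
  define \<phi> where "\<phi> s = g (p s z0)" for s
  have p_in: "p s z \<in> f ` ball 0 1" if "s \<in> {0..1}" "cmod z < 1" for s z
    unfolding p_def using that tz by (intro convexD_alt[OF conv]) auto
  have op: "open (f ` ball 0 1)" by (rule open_mapping_thm3[OF hol open_ball inj])
  have le: "cmod (\<phi> s) \<le> cmod (\<phi> 0)" if s: "s \<in> {0..1}" for s
  proof -
    have "(\<lambda>z. f (t * z)) holomorphic_on ball 0 1"
      by (rule holomorphic_on_compose_gen[of _ _ f, unfolded o_def, OF _ hol])
        (use tz in \<open>auto intro!: holomorphic_intros\<close>)
    then have ps: "p s holomorphic_on ball 0 1"
      unfolding p_def[abs_def] scaleR_conv_of_real using hol by (intro holomorphic_intros)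
    have "cmod (g (p s z0)) \<le> cmod z0"
    proof (rule Schwarz_Lemma(1)[where f = "\<lambda>z. g (p s z)"])
      show "(\<lambda>z. g (p s z)) holomorphic_on ball 0 1"
        by (rule holomorphic_on_compose_gen[of _ _ g, unfolded o_def, OF ps g(1)])
          (use p_in s in auto)
      show "g (p s 0) = 0" using g(3)[of 0] f0 by (simp add: p_def)
      show "cmod (g (p s z)) < 1" if "cmod z < 1" for z
        using p_in[OF s that] g(3) by auto
    qed (rule z0)
    then show ?thesis using g(3)[of z0] z0 by (simp add: \<phi>_def p_def)
  qed
  have fz0: "f z0 \<in> f ` ball 0 1" using z0 by auto
  have \<phi>_der: "(\<phi> has_vector_derivative (f w - f z0) / deriv f z0) (at 0 within {0..1})"
  proof -
    have "(g has_field_derivative deriv g (f z0)) (at (f z0))"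
      using holomorphic_derivI[OF g(1) op fz0] .
    then have "((\<lambda>s. g ((1 - s) * f z0 + s * f w)) has_field_derivative
        deriv g (f z0) * (f w - f z0)) (at (of_real 0))"
      by (auto intro!: derivative_eq_intros DERIV_chain'[where g = g])
    then have "((\<lambda>s. g ((1 - of_real s) * f z0 + of_real s * f w)) has_vector_derivative
        deriv g (f z0) * (f w - f z0)) (at 0 within {0..1})"
      by (rule has_vector_derivative_real_field)
    moreover have "deriv g (f z0) * (f w - f z0) = (f w - f z0) / deriv f z0"
    proof -
      have "deriv f z0 * deriv g (f z0) = 1" using g(2)[of z0] z0 by simp
      then have "deriv g (f z0) = 1 / deriv f z0" by (metis divide_eq_eq mult.commute mult_zero_left zero_neq_one)
      then show ?thesis by simp
    qed
    moreover have "t * z0 = w" using z0 by (simp add: t_def)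
    ultimately show ?thesis by (simp add: \<phi>_def[abs_def] p_def scaleR_conv_of_real)
  qed
  have \<phi>0: "\<phi> 0 = z0" using g(3)[of z0] z0 by (simp add: \<phi>_def p_def)
  define q where "q = (f z0 - f w) / (z0 * deriv f z0)"
  have "Re (cnj z0 * ((f w - f z0) / deriv f z0)) \<le> 0"
    using boundary_derivative_le[OF \<phi>_der le] \<phi>0 by simp
  also have "cnj z0 * ((f w - f z0) / deriv f z0) = - (of_real ((cmod z0)\<^sup>2) * q)"
    unfolding complex_norm_square q_def using z0
    by (simp add: divide_simps) (simp add: algebra_simps)
  finally have "0 \<le> (cmod z0)\<^sup>2 * Re q" by (simp del: of_real_power)
  then show ?thesis using z0 by (simp add: zero_le_mult_iff q_def)
qed

text \<open>
  Convex functions are starlike of order one half. With \<open>A = f z0 / (z0 * f' z0)\<close>, the map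
  \<open>v w = (f z0 - f w) / (z0 * f' z0)\<close> sends the disc of radius \<open>\<bar>z0\<bar>\<close> into the right half-plane, with
  \<open>v 0 = A\<close> and \<open>v z0 = 0\<close>. The Cayley transform \<open>(A - v) / (cnj A + v)\<close> carries this to the unit disc,
  vanishes at \<open>0\<close> and has modulus one at \<open>z0\<close>; the factor \<open>k \<ge> 1\<close> of Jack's lemma computes to
  \<open>2 * Re A / \<bar>A\<bar>\<^sup>2 = 2 * Re (1 / A)\<close>.
\<close>
lemma class_C_starlike_half:
  assumes f: "f \<in> class_C" and z0: "z0 \<noteq> 0" "cmod z0 < 1"
  shows "Re (z0 * deriv f z0 / f z0) \<ge> 1 / 2"
proof -
  have S: "f \<in> class_S" and hol: "f holomorphic_on ball 0 1" and inj: "inj_on f (ball 0 1)"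
    and f0: "f 0 = 0"
    using f by (auto simp: class_C_def class_S_def)
  have d0: "deriv f z0 \<noteq> 0" using deriv_nonzero_class_S[OF S z0(2)] .
  define c where "c = z0 * deriv f z0"
  define A where "A = f z0 / c"
  define v where "v w = (f z0 - f w) / c" for w
  have c0: "c \<noteq> 0" using d0 z0 by (simp add: c_def)
  have hol': "f holomorphic_on ball 0 (cmod z0)"
    by (rule holomorphic_on_subset[OF hol]) (use z0 in auto)
  have v_hol: "v holomorphic_on ball 0 (cmod z0)"
    unfolding v_def using c0 hol' by (intro holomorphic_intros) auto
  have v_ge: "Re (v w) \<ge> 0" if "cmod w \<le> cmod z0" for w
    unfolding v_def c_def using class_C_half_plane[OF f that z0] .
  \<comment> \<open>A non-strict bound on the open image of an injective map is strict.\<close>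
  have v_gt: "Re (v w) > 0" if w: "cmod w < cmod z0" for w
  proof -
    have "inj_on v (ball 0 (cmod z0))"
      using inj c0 z0 by (auto simp: inj_on_def v_def)
    then have "open (v ` ball 0 (cmod z0))"
      by (rule open_mapping_thm3[OF v_hol open_ball])
    then obtain e where e: "e > 0" "ball (v w) e \<subseteq> v ` ball 0 (cmod z0)"
      using w by (metis image_eqI mem_ball_0 open_contains_ball)
    have "v w - of_real (e / 2) \<in> ball (v w) e" using e(1) by (simp add: dist_norm)
    then have "v w - of_real (e / 2) \<in> v ` ball 0 (cmod z0)" using e(2) by blast
    then obtain u where "u \<in> ball 0 (cmod z0)" "v u = v w - of_real (e / 2)"
      by (elim imageE) metis
    then show ?thesis using v_ge[of u] e(1) by simp
  qed
  have ReA: "Re A > 0" using v_gt[of 0] z0 f0 by (simp add: A_def v_def)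
  define q where "q w = (A - v w) / (cnj A + v w)" for w
  have den: "cnj A + v w \<noteq> 0" if "cmod w \<le> cmod z0" for w
    using v_ge[OF that] ReA by (auto simp: complex_eq_iff)
  have vz0: "v z0 = 0" by (simp add: v_def)
  have A0: "A \<noteq> 0" using ReA by auto
  have "(f has_field_derivative deriv f z0) (at z0)"
    using holomorphic_derivI[OF hol open_ball] z0 by simp
  then have "(v has_field_derivative - deriv f z0 / c) (at z0)"
    unfolding v_def using c0 by (auto intro!: derivative_eq_intros)
  from DERIV_divide[OF DERIV_diff[OF DERIV_const[of A] this] DERIV_add[OF DERIV_const[of "cnj A"] this] den]
  have q_der: "(q has_field_derivative
      (deriv f z0 / c) * (cnj A + A) / (cnj A)\<^sup>2) (at z0)"
    unfolding q_def[abs_def] vz0 by (rule DERIV_cong) (use A0 c0 in \<open>auto simp: power2_eq_square field_simps\<close>)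
  obtain k where k: "k \<ge> 1" "z0 * ((deriv f z0 / c) * (cnj A + A) / (cnj A)\<^sup>2) = of_real k * q z0"
  proof (rule Jack_lemma[OF _ _ q_der])
    show "q holomorphic_on ball 0 (cmod z0)"
      unfolding q_def using v_hol den by (intro holomorphic_intros) auto
    show "q 0 = 0" by (simp add: q_def v_def A_def f0)
    show "q z0 \<noteq> 0" using A0 by (simp add: q_def vz0)
    show "cmod (q z) \<le> cmod (q z0)" if "cmod z < cmod z0" for z
    proof -
      have "(cmod (A - v z))\<^sup>2 \<le> (cmod (cnj A + v z))\<^sup>2"
        using v_gt[OF that] ReA unfolding cmod_power2 by (simp add: power2_eq_square algebra_simps)
      then have "cmod (A - v z) \<le> cmod (cnj A + v z)" by (rule power2_le_imp_le) simp
      moreover have "cmod (q z0) = 1" using A0 by (simp add: q_def vz0 norm_divide)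
      ultimately show ?thesis
        using den[of z] that by (simp add: q_def[of z] norm_divide divide_le_eq)
    qed
  qed
  have "z0 * ((deriv f z0 / c) * (cnj A + A) / (cnj A)\<^sup>2) = (cnj A + A) / (cnj A)\<^sup>2"
    using c0 by (simp add: c_def)
  with k have "(cnj A + A) / (cnj A)\<^sup>2 = of_real k * (A / cnj A)"
    by (simp add: q_def vz0)
  then have "cnj A + A = of_real k * (A / cnj A) * (cnj A)\<^sup>2"
    using A0 by (simp only: divide_eq_eq) simp
  also have "\<dots> = of_real k * (A * cnj A)"
    using A0 by (simp add: power2_eq_square)
  also have "A * cnj A = of_real ((cmod A)\<^sup>2)" by (rule complex_norm_square[symmetric])
  finally have "2 * Re A = k * (cmod A)\<^sup>2"
    by (simp add: complex_eq_iff del: of_real_power)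
  with k(1) have "(cmod A)\<^sup>2 \<le> 2 * Re A"
    using mult_right_mono[of 1 k "(cmod A)\<^sup>2"] by simp
  moreover have "Re (1 / A) = Re A / (cmod A)\<^sup>2"
    by (simp add: Re_divide cmod_power2)
  ultimately have "Re (1 / A) \<ge> 1 / 2"
    using A0 by (simp add: pos_le_divide_eq)
  then show ?thesis by (simp add: A_def c_def)
qed

text \<open>
  Put \<open>G z = f z / z\<close> and \<open>W = 1 - 1 / G\<close>, so that \<open>\<bar>W\<bar> > 1\<close> exactly where \<open>Re G < 1/2\<close>. If this happens,
  take a maximum point \<open>z0\<close> of \<open>\<bar>W\<bar>\<close> on a closed disc containing such a point. Jack's lemma turns into
  \<open>z0 * f' z0 / f z0 = 1 - k + k * G z0\<close> with \<open>k \<ge> 1\<close>, whose real part is below \<open>1 - k / 2 \<le> 1/2\<close>,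
  against starlikeness of order one half.
\<close>
lemma class_C_Re_quotient:
  assumes f: "f \<in> class_C" and z: "z \<noteq> 0" "cmod z < 1"
  shows "Re (f z / z) \<ge> 1 / 2"
proof (rule ccontr)
  assume neg: "\<not> ?thesis"
  have hol: "f holomorphic_on ball 0 1" and inj: "inj_on f (ball 0 1)"
    and f0: "f 0 = 0" and f'0: "deriv f 0 = 1"
    using f by (auto simp: class_C_def class_S_def)
  have fnz: "f w \<noteq> 0" if "w \<noteq> 0" "cmod w < 1" for w
    using inj_onD[OF inj, of w 0] f0 that by auto
  define G where "G w = (if w = 0 then 1 else f w / w)" for w
  have G_hol: "G holomorphic_on ball 0 1"
    using pole_theorem_open_0[OF hol open_ball, where f = G and a = 0] f0 f'0 by (auto simp: G_def)
  have Gnz: "G w \<noteq> 0" if "cmod w < 1" for w using fnz that by (auto simp: G_def)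
  define W where "W w = 1 - 1 / G w" for w
  have W_hol: "W holomorphic_on ball 0 1"
    unfolding W_def using G_hol Gnz by (intro holomorphic_intros) auto
  have W_gt: "cmod (W w) > 1 \<longleftrightarrow> Re (G w) < 1 / 2" if "cmod w < 1" for w
  proof -
    have "cmod (W w) = cmod (G w - 1) / cmod (G w)"
      using Gnz[OF that] by (simp add: W_def field_simps flip: norm_divide)
    then have "cmod (W w) > 1 \<longleftrightarrow> cmod (G w - 1) > cmod (G w)"
      using Gnz[OF that] by (simp add: less_divide_eq)
    also have "\<dots> \<longleftrightarrow> (cmod (G w))\<^sup>2 < (cmod (G w - 1))\<^sup>2"
      by (meson norm_ge_zero power2_less_imp_less power_strict_mono zero_less_numeral)
    also have "\<dots> \<longleftrightarrow> Re (G w) < 1 / 2"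
      unfolding cmod_power2 by (simp add: power2_eq_square algebra_simps)
    finally show ?thesis .
  qed
  have "continuous_on (cball 0 (cmod z)) (\<lambda>w. cmod (W w))"
    using W_hol z by (intro continuous_intros holomorphic_on_imp_continuous_on)
      (auto elim: holomorphic_on_subset)
  then obtain z0 where z0: "cmod z0 \<le> cmod z" "\<And>w. cmod w \<le> cmod z \<Longrightarrow> cmod (W w) \<le> cmod (W z0)"
    using continuous_attains_sup[of "cball 0 (cmod z)" "\<lambda>w. cmod (W w)"] by auto
  have z01: "cmod z0 < 1" using z0(1) z(2) by simp
  have "cmod (W z) > 1" using W_gt[OF z(2)] neg z by (simp add: G_def)
  then have Wz0: "cmod (W z0) > 1" using z0(2)[of z] by simp
  then have ReG: "Re (G z0) < 1 / 2" using W_gt[OF z01] by simp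
  then have z0nz: "z0 \<noteq> 0" by (auto simp: G_def)
  have fz0: "f z0 \<noteq> 0" using fnz z0nz z01 by blast
  have "(f has_field_derivative deriv f z0) (at z0)"
    using holomorphic_derivI[OF hol open_ball] z01 by simp
  then have "((\<lambda>w. 1 - w / f w) has_field_derivative - (f z0 - z0 * deriv f z0) / (f z0)\<^sup>2) (at z0)"
    using fz0 by (auto intro!: derivative_eq_intros simp: power2_eq_square field_simps)
  moreover have "\<forall>\<^sub>F w in nhds z0. 1 - w / f w = W w"
    using t1_space_nhds[OF z0nz] by eventually_elim (simp add: W_def G_def)
  ultimately have W_der: "(W has_field_derivative - (f z0 - z0 * deriv f z0) / (f z0)\<^sup>2) (at z0)"
    by (rule DERIV_cong_ev[OF refl _ refl, THEN iffD1, rotated])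
  obtain k where k: "k \<ge> 1" "z0 * (- (f z0 - z0 * deriv f z0) / (f z0)\<^sup>2) = of_real k * W z0"
  proof (rule Jack_lemma[OF _ _ W_der])
    show "W holomorphic_on ball 0 (cmod z0)"
      by (rule holomorphic_on_subset[OF W_hol]) (use z01 in auto)
    show "W 0 = 0" by (simp add: W_def G_def)
    show "W z0 \<noteq> 0" using Wz0 by auto
    show "cmod (W w) \<le> cmod (W z0)" if "cmod w < cmod z0" for w
      using z0 that by simp
  qed
  have "z0 * deriv f z0 / f z0 = 1 + z0 * (- (f z0 - z0 * deriv f z0) / (f z0)\<^sup>2) * G z0"
    using z0nz fz0 by (simp add: G_def power2_eq_square divide_simps)
  also have "\<dots> = 1 - of_real k + of_real k * G z0"
    unfolding k(2) W_def using Gnz[OF z01] by (simp add: field_simps)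
  finally have "Re (z0 * deriv f z0 / f z0) = 1 - k + k * Re (G z0)" by simp
  also have "k * Re (G z0) < k * (1 / 2)" using ReG k(1) by (intro mult_strict_left_mono) auto
  also have "1 - k + k * (1 / 2) \<le> 1 / 2" using k(1) by simp
  finally show False using class_C_starlike_half[OF f z0nz z01] by simp
qed

text \<open>
  Multiplying the half-plane bound by \<open>\<bar>z\<bar>\<^sup>2\<close> makes it affine in \<open>f\<close> and meaningful at \<open>z = 0\<close>.
\<close>
lemma closure_hull_class_C_Re:
  assumes f: "f \<in> compact_convergence (ball 0 1) closure_of (convex hull class_C)"
    and z: "cmod z < 1"
  shows "(cmod z)\<^sup>2 / 2 \<le> Re (cnj z * f z)"
proof -
  define H where "H = {g. (cmod z)\<^sup>2 / 2 \<le> Re (cnj z * g z)}"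
  have "class_C \<subseteq> H"
  proof
    fix g assume g: "g \<in> class_C"
    show "g \<in> H"
    proof (cases "z = 0")
      case False
      have "cnj z * g z = of_real ((cmod z)\<^sup>2) * (g z / z)"
        unfolding complex_norm_square using False by simp
      then have "Re (cnj z * g z) = (cmod z)\<^sup>2 * Re (g z / z)"
        by (metis Re_complex_of_real Im_complex_of_real times_complex.simps(1) mult_zero_left diff_zero)
      then show ?thesis
        using mult_left_mono[OF class_C_Re_quotient[OF g False z], of "(cmod z)\<^sup>2"]
        by (simp add: H_def)
    qed (simp add: H_def)
  qed
  moreover have "convex H"
  proof (rule convexI)
    fix g h and u v :: real
    assume gh: "g \<in> H" "h \<in> H" and uv: "0 \<le> u" "0 \<le> v" "u + v = 1"
    have "(cmod z)\<^sup>2 / 2 = u * ((cmod z)\<^sup>2 / 2) + v * ((cmod z)\<^sup>2 / 2)"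
      using uv(3) by (metis distrib_right mult_1)
    also have "\<dots> \<le> u * Re (cnj z * g z) + v * Re (cnj z * h z)"
      using gh uv by (intro add_mono mult_left_mono) (auto simp: H_def)
    also have "\<dots> = Re (cnj z * (u *\<^sub>R g + v *\<^sub>R h) z)"
      by (simp add: scaleR_fun_def algebra_simps)
    finally show "u *\<^sub>R g + v *\<^sub>R h \<in> H" by (simp add: H_def)
  qed
  ultimately have sub: "convex hull class_C \<subseteq> H" by (rule hull_minimal)
  show ?thesis
  proof (rule field_le_epsilon)
    fix e :: real assume e: "e > 0"
    have "compact {z}" "{z} \<subseteq> ball 0 1" using z by auto
    with f e obtain g where g: "g \<in> convex hull class_C" "dist (g z) (f z) < e"
      unfolding in_closure_of_compact_convergence by blast
    have "Re (cnj z * (g z - f z)) \<le> cmod z * dist (g z) (f z)"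
      using complex_Re_le_cmod[of "cnj z * (g z - f z)"] by (simp add: norm_mult dist_norm)
    also have "\<dots> \<le> 1 * e" using z g(2) by (intro mult_mono) auto
    finally have "Re (cnj z * g z) \<le> Re (cnj z * f z) + e" by (simp add: algebra_simps)
    moreover have "(cmod z)\<^sup>2 / 2 \<le> Re (cnj z * g z)" using sub g(1) by (auto simp: H_def)
    ultimately show "(cmod z)\<^sup>2 / 2 \<le> Re (cnj z * f z) + e" by linarith
  qed
qed

section \<open>Positivity of the Toeplitz form\<close>

text \<open>
  For moments \<open>c k = \<integral> w ^ k d\<mu>\<close> of a measure on the circle, \<open>herm c\<close> is the full two-sided sequence of
  moments.
\<close>
definition herm :: "(nat \<Rightarrow> complex) \<Rightarrow> int \<Rightarrow> complex" where
  "herm c d = (if d \<ge> 0 then c (nat d) else cnj (c (nat (- d))))"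

text \<open>
  The double sum is \<open>\<integral> \<bar>\<Sum>i\<in>I. x i * w ^ e i\<bar>\<^sup>2 d\<mu>\<close> if \<open>\<gamma>\<close> consists of the moments of \<open>\<mu>\<close>. Exponents are
  given by an arbitrary function \<open>e\<close> so that they may coincide, which saves case distinctions in the
  three-point forms below.
\<close>
definition Toeplitz_positive :: "(int \<Rightarrow> complex) \<Rightarrow> bool" where
  "Toeplitz_positive \<gamma> \<longleftrightarrow> (\<forall>(I::nat set) e x. finite I \<longrightarrow>
     (\<Sum>i\<in>I. \<Sum>l\<in>I. x i * cnj (x l) * \<gamma> (e i - e l)) \<in> \<real>\<^sub>\<ge>\<^sub>0)"

definition circ :: "real \<Rightarrow> complex" where
  "circ t = exp (2 * of_real pi * \<i> * of_real t)"

lemma norm_circ [simp]: "cmod (circ t) = 1"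
  by (simp add: circ_def)

lemma circ_nonzero [simp]: "circ t \<noteq> 0"
  by (simp add: circ_def)

lemma cnj_circ: "cnj (circ t) = inverse (circ t)"
  by (simp add: circ_def exp_minus[symmetric] exp_cnj)

lemma cnj_circ_powi: "cnj (circ t powi k) = circ t powi (- k)"
  by (cases k rule: int_cases2) (simp_all add: cnj_circ power_int_minus power_inverse)

text \<open>
  Cauchy's formula for the Taylor coefficients, and Cauchy's theorem for the negative frequencies.
\<close>
lemma power_series_circle_coefficients:
  assumes F: "\<And>z. cmod z < 1 \<Longrightarrow> (\<lambda>k. c k * z ^ k) sums F z" and r: "0 < r" "r < 1"
  shows "((\<lambda>t. F (of_real r * circ t) * circ t powi (- k)) has_integral
      (if k \<ge> 0 then of_real r ^ nat k * c (nat k) else 0)) {0..1}"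
proof -
  have hol: "F holomorphic_on ball 0 1"
    using F by (intro power_series_holomorphic[of 0 1 c]) auto
  have cont: "continuous_on (cball 0 r) F"
    by (rule holomorphic_on_imp_continuous_on, rule holomorphic_on_subset[OF hol]) (use r in auto)
  have hol': "F holomorphic_on ball 0 r"
    by (rule holomorphic_on_subset[OF hol]) (use r in auto)
  have cp: "circlepath 0 r = (\<lambda>t. of_real r * circ t)"
    by (simp add: circlepath circ_def)
  have vd: "vector_derivative (\<lambda>t. of_real r * circ t) (at t) = 2 * of_real pi * \<i> * (of_real r * circ t)" for t
    using vector_derivative_circlepath[of 0 r t] unfolding cp by (simp add: circ_def mult_ac)
  show ?thesis
  proof (cases "k \<ge> 0")
    case True
    then obtain n where n: "k = int n" by (metis nonneg_int_cases)
    have "F has_fps_expansion Abs_fps c"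
      using F by (intro has_fps_expansionI eventually_nhds_in_open[of "ball 0 1", THEN eventually_mono]) auto
    then have "c n = (deriv ^^ n) F 0 / fact n"
      using fps_nth_fps_expansion by fastforce
    then have "((\<lambda>u. F u / (u - 0) ^ Suc n) has_contour_integral (2 * of_real pi * \<i>) * c n) (circlepath 0 r)"
      using Cauchy_has_contour_integral_higher_derivative_circlepath[OF cont hol', of 0 n] r by simp
    then have int: "((\<lambda>t. F (of_real r * circ t) / (of_real r * circ t) ^ Suc n * (2 * of_real pi * \<i> * (of_real r * circ t)))
        has_integral (2 * of_real pi * \<i>) * c n) {0..1}"
      unfolding has_contour_integral cp vd diff_zero .
    have cancel: "x / K * (K * y) = x * y" if "K \<noteq> 0" for x K y :: complex
      using that by simp
    note has_integral_mult_right[OF int, of "of_real r ^ n / (2 * of_real pi * \<i>)"]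
    also have "of_real r ^ n / (2 * of_real pi * \<i>) * ((2 * of_real pi * \<i>) * c n) = of_real r ^ n * c n"
      by (rule cancel) simp
    also have "(\<lambda>t. of_real r ^ n / (2 * of_real pi * \<i>) * (F (of_real r * circ t) / (of_real r * circ t) ^ Suc n
        * (2 * of_real pi * \<i> * (of_real r * circ t)))) = (\<lambda>t. F (of_real r * circ t) * circ t powi (- k))"
      using r by (simp add: n power_int_minus field_simps)
    finally show ?thesis using n by simp
  next
    case False
    define n where "n = nat (- k) - 1"
    have n: "- k = int (Suc n)" using False by (simp add: n_def)
    have "((\<lambda>u. F u * u ^ n) has_contour_integral 0) (circlepath 0 r)"
    proof (rule Cauchy_theorem_disc_simple)
      show "(\<lambda>u. F u * u ^ n) holomorphic_on ball 0 1" using hol by (intro holomorphic_intros)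
    qed (use r in auto)
    then have "((\<lambda>t. F (of_real r * circ t) * (of_real r * circ t) ^ n * (2 * of_real pi * \<i> * (of_real r * circ t)))
        has_integral 0) {0..1}"
      unfolding has_contour_integral cp vd diff_zero .
    note has_integral_mult_right[OF this, of "1 / (of_real r ^ Suc n * (2 * of_real pi * \<i>))"]
    also have "(\<lambda>t. 1 / (of_real r ^ Suc n * (2 * of_real pi * \<i>)) * (F (of_real r * circ t) * (of_real r * circ t) ^ n
        * (2 * of_real pi * \<i> * (of_real r * circ t)))) = (\<lambda>t. F (of_real r * circ t) * circ t powi (- k))"
      unfolding n power_int_of_nat using r by (simp add: power_mult_distrib field_simps)
    finally show ?thesis using False by (simp only: mult_zero_right if_False)
  qed
qed

text \<open>
  On the circle of radius \<open>r\<close>, \<open>2 Re F - 1 = F + cnj F - 1\<close> is the Poisson extension of the Herglotz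
  measure: \<open>F\<close> contributes the frequencies \<open>k \<ge> 0\<close>, \<open>cnj F\<close> those with \<open>k \<le> 0\<close>, and \<open>- 1\<close>
  corrects the frequency \<open>0\<close>, which has been counted twice.
\<close>
lemma circle_density_moments:
  assumes F: "\<And>z. cmod z < 1 \<Longrightarrow> (\<lambda>k. c k * z ^ k) sums F z" and c0: "c 0 = 1"
    and r: "0 < r" "r < 1"
  shows "((\<lambda>t. of_real (2 * Re (F (of_real r * circ t)) - 1) * circ t powi (- k)) has_integral
      of_real r ^ nat \<bar>k\<bar> * herm c k) {0..1}"
proof -
  let ?F = "\<lambda>t. F (of_real r * circ t)"
  define J where "J k = (if k \<ge> 0 then of_real r ^ nat k * c (nat k) else 0)" for k
  have "((\<lambda>t. ?F t * circ t powi (- k)) has_integral J k) {0..1}"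
    unfolding J_def by (rule power_series_circle_coefficients[OF F r])
  moreover have "((\<lambda>t. cnj (?F t * circ t powi (- (- k)))) has_integral cnj (J (- k))) {0..1}"
    unfolding J_def has_integral_cnj[unfolded o_def]
    by (rule power_series_circle_coefficients[OF F r])
  \<comment> \<open>Orthogonality of the characters is the case of the constant power series.\<close>
  moreover have "((\<lambda>t. 1 * circ t powi (- k)) has_integral (if k = 0 then 1 else 0)) {0..1}"
  proof -
    have "(\<lambda>j. (if j = 0 then 1 else 0) * z ^ j) sums 1" for z :: complex
      using sums_single[of 0 "\<lambda>j. z ^ j"] by (simp add: if_distrib[of "\<lambda>x. x * _"] cong: if_cong)
    then show ?thesis
      using power_series_circle_coefficients[of "\<lambda>j. if j = 0 then 1 else 0" "\<lambda>_. 1" r k] r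
      by (auto split: if_splits)
  qed
  ultimately have "((\<lambda>t. ?F t * circ t powi (- k) + cnj (?F t * circ t powi (- (- k))) - 1 * circ t powi (- k))
      has_integral J k + cnj (J (- k)) - (if k = 0 then 1 else 0)) {0..1}"
    by (intro has_integral_add has_integral_diff)
  moreover have "?F t * circ t powi (- k) + cnj (?F t * circ t powi (- (- k))) - 1 * circ t powi (- k) =
      of_real (2 * Re (?F t) - 1) * circ t powi (- k)" for t
  proof -
    have "cnj (circ t powi (- (- k))) = circ t powi (- k)"
      by (simp only: cnj_circ_powi minus_minus)
    then have "?F t * circ t powi (- k) + cnj (?F t * circ t powi (- (- k))) - 1 * circ t powi (- k) =
      (?F t + cnj (?F t) - 1) * circ t powi (- k)"
      by (simp only: complex_cnj_mult) (simp only: algebra_simps)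
    then show ?thesis unfolding complex_add_cnj by simp
  qed
  moreover have "J k + cnj (J (- k)) - (if k = 0 then 1 else 0) = of_real r ^ nat \<bar>k\<bar> * herm c k"
    using c0 by (auto simp: J_def herm_def)
  ultimately show ?thesis by simp
qed

text \<open>
  For \<open>r < 1\<close> the Toeplitz form of the damped moments \<open>r ^ \<bar>k\<bar> * c k\<close> is the integral of
  \<open>\<bar>p\<bar>\<^sup>2\<close> against the non-negative density \<open>2 Re F - 1\<close>; let \<open>r\<close> tend to \<open>1\<close>.
\<close>
lemma Toeplitz_positive_of_Re_ge_half:
  assumes F: "\<And>z. cmod z < 1 \<Longrightarrow> (\<lambda>k. c k * z ^ k) sums F z" and c0: "c 0 = 1"
    and Re: "\<And>z. cmod z < 1 \<Longrightarrow> Re (F z) \<ge> 1 / 2"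
  shows "Toeplitz_positive (herm c)"
  unfolding Toeplitz_positive_def
proof (intro allI impI)
  fix I :: "nat set" and e :: "nat \<Rightarrow> int" and x :: "nat \<Rightarrow> complex"
  assume I: "finite I"
  define Q where "Q r = (\<Sum>i\<in>I. \<Sum>l\<in>I. x i * cnj (x l) * (of_real r ^ nat \<bar>e i - e l\<bar> * herm c (e i - e l)))"
    for r :: real
  have "Q r \<in> \<real>\<^sub>\<ge>\<^sub>0" if r: "0 < r" "r < 1" for r
  proof -
    define P where "P t = 2 * Re (F (of_real r * circ t)) - 1" for t
    define S where "S t = (\<Sum>i\<in>I. x i * circ t powi (- e i))" for t
    have "((\<lambda>t. \<Sum>i\<in>I. \<Sum>l\<in>I. x i * cnj (x l) * (of_real (P t) * circ t powi (- (e i - e l))))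
        has_integral Q r) {0..1}"
      unfolding Q_def P_def
      by (intro has_integral_sum I has_integral_mult_right circle_density_moments[OF F c0 r])
    moreover have "(\<Sum>i\<in>I. \<Sum>l\<in>I. x i * cnj (x l) * (of_real (P t) * circ t powi (- (e i - e l))))
        = of_real (P t * (cmod (S t))\<^sup>2)" for t
    proof -
      have "circ t powi (- (e i - e l)) = circ t powi (- e i) * cnj (circ t powi (- e l))" for i l
        unfolding cnj_circ_powi by (simp add: power_int_add[symmetric])
      then have "(\<Sum>i\<in>I. \<Sum>l\<in>I. x i * cnj (x l) * (of_real (P t) * circ t powi (- (e i - e l))))
        = of_real (P t) * (S t * cnj (S t))"
        unfolding S_def cnj_sum sum_product by (simp add: sum_distrib_left mult_ac)
      then show ?thesis by (simp only: of_real_mult complex_norm_square)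
    qed
    ultimately have int: "((\<lambda>t. complex_of_real (P t * (cmod (S t))\<^sup>2)) has_integral Q r) {0..1}" by simp
    have "((\<lambda>t. P t * (cmod (S t))\<^sup>2) has_integral Re (Q r)) {0..1}"
      using has_integral_Re[OF int] by simp
    moreover have "P t * (cmod (S t))\<^sup>2 \<ge> 0" for t
      using Re[of "of_real r * circ t"] r by (simp add: P_def norm_mult)
    ultimately have "Re (Q r) \<ge> 0" by (rule has_integral_nonneg)
    moreover have "Im (Q r) = 0"
      using has_integral_unique[OF has_integral_Im[OF int]] by simp
    ultimately show ?thesis by (simp add: complex_nonneg_Reals_iff)
  qed
  then have "\<forall>\<^sub>F r in at_left 1. Q r \<in> \<real>\<^sub>\<ge>\<^sub>0"
    using eventually_at_left_real[of 0 "1::real"] by (auto elim: eventually_mono)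
  moreover have "(Q \<longlongrightarrow> Q 1) (at_left 1)"
    unfolding Q_def by (intro tendsto_intros)
  ultimately have "Q 1 \<in> \<real>\<^sub>\<ge>\<^sub>0"
    by (intro Lim_in_closed_set[of "\<real>\<^sub>\<ge>\<^sub>0" Q]) auto
  then show "(\<Sum>i\<in>I. \<Sum>l\<in>I. x i * cnj (x l) * herm c (e i - e l)) \<in> \<real>\<^sub>\<ge>\<^sub>0"
    by (simp add: Q_def)
qed

section \<open>Consequences of positivity for the moments\<close>
lemma herm_of_nat [simp]: "herm c (int k) = c k"
  by (simp add: herm_def)

lemma herm_0 [simp]: "herm c 0 = c 0"
  by (simp add: herm_def)

lemma herm_minus: "c 0 = 1 \<Longrightarrow> herm c (- d) = cnj (herm c d)"
  by (cases "d = 0") (auto simp: herm_def)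

lemma Toeplitz_positiveD:
  fixes I :: "nat set"
  assumes "Toeplitz_positive \<gamma>" "finite I"
  shows "(\<Sum>i\<in>I. \<Sum>l\<in>I. x i * cnj (x l) * \<gamma> (e i - e l)) \<in> \<real>\<^sub>\<ge>\<^sub>0"
  using assms unfolding Toeplitz_positive_def by (elim allE[of _ I] allE[of _ e] allE[of _ x]) simp

lemma Toeplitz_positive_three:
  assumes "Toeplitz_positive \<gamma>"
  shows "Re (x * cnj x * \<gamma> 0 + x * cnj y * \<gamma> (p - q) + x * cnj z * \<gamma> (p - r)
           + (y * cnj x * \<gamma> (q - p) + y * cnj y * \<gamma> 0 + y * cnj z * \<gamma> (q - r))
           + (z * cnj x * \<gamma> (r - p) + z * cnj y * \<gamma> (r - q) + z * cnj z * \<gamma> 0)) \<ge> 0"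
proof -
  define e where "e i = (if i = 0 then p else if i = 1 then q else r)" for i :: nat
  define X where "X i = (if i = 0 then x else if i = 1 then y else z)" for i :: nat
  have "(\<Sum>i\<in>{0, 1, 2}. \<Sum>l\<in>{0, 1, 2}. X i * cnj (X l) * \<gamma> (e i - e l)) \<in> \<real>\<^sub>\<ge>\<^sub>0"
    using assms by (rule Toeplitz_positiveD) simp
  also have "(\<Sum>i\<in>{0, 1, 2}. \<Sum>l\<in>{0, 1, 2}. X i * cnj (X l) * \<gamma> (e i - e l)) =
      x * cnj x * \<gamma> 0 + x * cnj y * \<gamma> (p - q) + x * cnj z * \<gamma> (p - r)
           + (y * cnj x * \<gamma> (q - p) + y * cnj y * \<gamma> 0 + y * cnj z * \<gamma> (q - r))
           + (z * cnj x * \<gamma> (r - p) + z * cnj y * \<gamma> (r - q) + z * cnj z * \<gamma> 0)"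
    by (simp add: e_def X_def add.assoc)
  finally show ?thesis unfolding complex_nonneg_Reals_iff by blast
qed

text \<open>
  This is \<open>\<bar>\<integral> g\<^sup>2 d\<mu>\<bar> \<le> \<integral> \<bar>g\<bar>\<^sup>2 d\<mu>\<close> for \<open>g = w ^ m - b\<close> with \<open>b = c m\<close>. To see it from the Toeplitz form,
  let \<open>\<bar>\<eta>\<bar> = 1\<close>: then \<open>2 \<bar>g\<bar>\<^sup>2 - 2 Re (\<eta>\<^sup>2 g\<^sup>2) = \<bar>\<eta> g - cnj (\<eta> g)\<bar>\<^sup>2\<close>, and multiplying the right-hand side
  inside the modulus by \<open>w ^ m\<close> turns it into the polynomial with coefficients \<open>- cnj \<eta>\<close>,
  \<open>cnj (\<eta> b) - \<eta> b\<close>, \<open>\<eta>\<close> at the exponents \<open>0\<close>, \<open>m\<close>, \<open>2 m\<close>.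
\<close>
lemma second_moment_bound:
  assumes pos: "Toeplitz_positive (herm c)" and c0: "c 0 = 1"
  shows "cmod (c (2 * m) - (c m)\<^sup>2) \<le> 1 - (cmod (c m))\<^sup>2"
proof (cases "c (2 * m) = (c m)\<^sup>2")
  case True
  \<comment> \<open>Only \<open>\<bar>c m\<bar> \<le> 1\<close> is at stake, which is the form at \<open>c m - w ^ m\<close>.\<close>
  have "Re (0 * cnj 0 * herm c 0 + 0 * cnj (c m) * herm c (0 - 0) + 0 * cnj (- 1) * herm c (0 - int m)
      + (c m * cnj 0 * herm c (0 - 0) + c m * cnj (c m) * herm c 0 + c m * cnj (- 1) * herm c (0 - int m))
      + (- 1 * cnj 0 * herm c (int m - 0) + - 1 * cnj (c m) * herm c (int m - 0) + - 1 * cnj (- 1) * herm c 0)) \<ge> 0"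
    by (rule Toeplitz_positive_three[OF pos])
  then show ?thesis
    using True c0 by (simp add: herm_minus cmod_power2) (simp add: power2_eq_square)
next
  case False
  define b d D where "b = c m" and "d = c (2 * m)" and "D = d - b\<^sup>2"
  \<comment> \<open>The rotation for which the real part of the square attains its modulus.\<close>
  define \<eta> where "\<eta> = csqrt (cnj (sgn D))"
  have D0: "D \<noteq> 0" using False by (simp add: D_def d_def b_def)
  have \<eta>2: "\<eta>\<^sup>2 * D = of_real (cmod D)"
    unfolding \<eta>_def power2_csqrt using D0
    by (simp add: sgn_eq complex_norm_square[symmetric] power2_eq_square mult.commute[of "cnj D"]
        flip: complex_norm_square)
  have \<eta>1: "\<eta> * cnj \<eta> = 1"
    using D0 by (simp add: complex_norm_square[symmetric] \<eta>_def norm_sgn flip: of_real_power)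
  have herm: "herm c 0 = 1" "herm c (int m) = b" "herm c (int (2 * m)) = d"
    "herm c (- int m) = cnj b" "herm c (- int (2 * m)) = cnj d"
    using c0 by (simp_all only: herm_minus[of c] herm_of_nat herm_0 b_def d_def)
  define x y where "x = - cnj \<eta>" and "y = cnj \<eta> * cnj b - \<eta> * b"
  have "Re (x * cnj x * herm c 0 + x * cnj y * herm c (0 - int m) + x * cnj \<eta> * herm c (0 - int (2 * m))
      + (y * cnj x * herm c (int m - 0) + y * cnj y * herm c 0 + y * cnj \<eta> * herm c (int m - int (2 * m)))
      + (\<eta> * cnj x * herm c (int (2 * m) - 0) + \<eta> * cnj y * herm c (int (2 * m) - int m) + \<eta> * cnj \<eta> * herm c 0)) \<ge> 0"
    by (rule Toeplitz_positive_three[OF pos])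
  moreover have "int m - int (2 * m) = - int m" "int (2 * m) - int m = int m" by simp_all
  ultimately have "Re (x * cnj x + x * cnj y * cnj b + x * cnj \<eta> * cnj d + (y * cnj x * b + y * cnj y + y * cnj \<eta> * cnj b)
      + (\<eta> * cnj x * d + \<eta> * cnj y * b + \<eta> * cnj \<eta>)) \<ge> 0"
    by (simp only: herm diff_0 diff_zero mult_1_right)
  also have "x * cnj x + x * cnj y * cnj b + x * cnj \<eta> * cnj d + (y * cnj x * b + y * cnj y + y * cnj \<eta> * cnj b)
      + (\<eta> * cnj x * d + \<eta> * cnj y * b + \<eta> * cnj \<eta>)
      = 2 * (1 - b * cnj b) - (\<eta>\<^sup>2 * D + cnj (\<eta>\<^sup>2 * D))"
    using \<eta>1 unfolding x_def y_def D_def complex_cnj_diff complex_cnj_mult complex_cnj_minus complex_cnj_cnj complex_cnj_power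
    by algebra
  finally show ?thesis
    unfolding \<eta>2 by (simp add: b_def d_def D_def cmod_power2) (simp add: power2_eq_square)
qed

text \<open>
  If \<open>\<bar>c N\<bar> = 1\<close> then \<open>w ^ N - c N\<close> has norm zero in the semi-inner product of the form, hence is
  orthogonal to every power of \<open>w\<close>. The defect \<open>D\<close> is its inner product with \<open>w ^ (- j)\<close>, and the form at
  \<open>(w ^ N - c N) - D * w ^ (- j)\<close> equals \<open>- \<bar>D\<bar>\<^sup>2\<close>.
\<close>
lemma herm_shift:
  assumes pos: "Toeplitz_positive (herm c)" and c0: "c 0 = 1" and N: "cmod (c N) = 1"
  shows "herm c (j + int N) = c N * herm c j"
proof -
  define D where "D = herm c (j + int N) - c N * herm c j"
  have h0: "herm c 0 = 1" using c0 by simp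
  have NN: "c N * cnj (c N) = 1" using N by (simp add: complex_norm_square[symmetric])
  have "Re (1 * cnj 1 * herm c 0 + 1 * cnj (- c N) * herm c (int N - 0) + 1 * cnj (- D) * herm c (int N - (- j))
      + (- c N * cnj 1 * herm c (0 - int N) + - c N * cnj (- c N) * herm c 0 + - c N * cnj (- D) * herm c (0 - (- j)))
      + (- D * cnj 1 * herm c (- j - int N) + - D * cnj (- c N) * herm c (- j - 0) + - D * cnj (- D) * herm c 0)) \<ge> 0"
    by (rule Toeplitz_positive_three[OF pos])
  also have "herm c (int N - (- j)) = D + c N * herm c j"
    by (simp add: D_def add.commute)
  also have "herm c (- j - int N) = cnj (D + c N * herm c j)"
    using herm_minus[of c "j + int N"] c0 by (simp add: D_def)
  also have "1 * cnj 1 * herm c 0 + 1 * cnj (- c N) * herm c (int N - 0) + 1 * cnj (- D) * (D + c N * herm c j)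
      + (- c N * cnj 1 * herm c (0 - int N) + - c N * cnj (- c N) * herm c 0 + - c N * cnj (- D) * herm c (0 - (- j)))
      + (- D * cnj 1 * cnj (D + c N * herm c j) + - D * cnj (- c N) * herm c (- j - 0) + - D * cnj (- D) * herm c 0)
      = - (D * cnj D)"
    using NN h0 herm_minus[of c j] herm_minus[of c "int N"] c0
    by (simp add: algebra_simps)
  finally have "(cmod D)\<^sup>2 \<le> 0"
    by (simp add: complex_norm_square[symmetric] flip: of_real_power)
  then show ?thesis by (simp add: D_def)
qed

lemma sum_periodic_shift:
  fixes g :: "int \<Rightarrow> complex"
  assumes per: "\<And>d. g (d + int N) = g d"
  shows "(\<Sum>i<N. g (int i - int l)) = (\<Sum>i<N. g (int i))"
proof (induction l)
  case (Suc l)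
  define h where "h i = g (int i - int (Suc l))" for i
  have "h 0 + (\<Sum>i<N. h (Suc i)) = (\<Sum>i<N. h i) + h N"
    by (rule sum.lessThan_Suc_shift[of h N, unfolded sum.lessThan_Suc, symmetric])
  moreover have "h N = h 0"
  proof -
    have "int N - int (Suc l) = - int (Suc l) + int N" "int 0 - int (Suc l) = - int (Suc l)" by simp_all
    then show ?thesis unfolding h_def by (simp only: per)
  qed
  ultimately have "(\<Sum>i<N. h i) = (\<Sum>i<N. h (Suc i))" by simp
  with Suc show ?case by (simp add: h_def)
qed simp

text \<open>
  The weight at a root \<open>w\<close> of \<open>w ^ N = c N\<close>. The Toeplitz form at the vector \<open>cnj w ^ i\<close>, \<open>i < N\<close>, is
  a double sum of \<open>g (i - l)\<close>, where \<open>g d = herm c d * w powi (- d)\<close> has period \<open>N\<close>; it is therefore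
  \<open>N\<^sup>2\<close> times the weight.
\<close>
lemma Fourier_weight_nonneg:
  assumes pos: "Toeplitz_positive (herm c)" and c0: "c 0 = 1" and N: "cmod (c N) = 1" "N > 0"
    and w: "w ^ N = c N"
  shows "(\<Sum>i<N. c i * cnj w ^ i) / of_nat N \<in> \<real>\<^sub>\<ge>\<^sub>0"
proof -
  have w1: "cmod w = 1"
  proof (rule power_eq_imp_eq_base)
    show "cmod w ^ N = 1 ^ N" using w N(1) by (simp add: norm_power[symmetric])
  qed (use N(2) in auto)
  then have ww: "w * cnj w = 1" by (simp add: complex_norm_square[symmetric])
  then have w0: "w \<noteq> 0" by auto
  have cw: "cnj w = inverse w" by (rule inverse_unique[OF ww, symmetric])
  define g where "g d = herm c d * w powi (- d)" for d
  have per: "g (d + int N) = g d" for d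
  proof -
    have "w powi (- (d + int N)) = w powi (- d) / c N"
      using w0 w by (simp add: power_int_diff minus_add_distrib)
    moreover have "c N \<noteq> 0" using N(1) by auto
    ultimately show ?thesis by (simp add: g_def herm_shift[OF pos c0 N(1)])
  qed
  have "(\<Sum>i<N. \<Sum>l<N. cnj w ^ i * cnj (cnj w ^ l) * herm c (int i - int l)) \<in> \<real>\<^sub>\<ge>\<^sub>0"
    by (rule Toeplitz_positiveD[OF pos]) simp
  also have "(\<Sum>i<N. \<Sum>l<N. cnj w ^ i * cnj (cnj w ^ l) * herm c (int i - int l))
      = (\<Sum>i<N. \<Sum>l<N. g (int i - int l))"
    using w0 by (intro sum.cong refl) (simp add: g_def cw power_int_diff power_inverse field_simps)
  also have "\<dots> = (\<Sum>l<N. \<Sum>i<N. g (int i - int l))"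
    by (rule sum.swap)
  also have "\<dots> = of_nat N * (\<Sum>i<N. g (int i))"
    by (simp add: sum_periodic_shift[of g N, OF per])
  also have "(\<Sum>i<N. g (int i)) = (\<Sum>i<N. c i * cnj w ^ i)"
    by (intro sum.cong refl) (simp add: g_def cw power_int_minus power_inverse)
  finally have "of_nat N * (\<Sum>i<N. c i * cnj w ^ i) \<in> \<real>\<^sub>\<ge>\<^sub>0" .
  from nonneg_Reals_divide_I[OF this nonneg_Reals_of_nat_I[of "N * N"]]
  show ?thesis using N(2) by simp
qed

section \<open>Recovering the masses by a discrete Fourier transform\<close>
lemma sum_powers_root_of_unity:
  fixes z :: complex
  assumes "z ^ N = 1" "z \<noteq> 1"
  shows "(\<Sum>k=1..N. z ^ k) = 0"
proof -
  have "(\<Sum>k<N. z ^ k) = 0"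
    using one_diff_power_eq[of z N] assms by simp
  then have "(\<Sum>k<N. z ^ Suc k) = 0"
    by (simp add: sum_distrib_left[symmetric])
  then show ?thesis unfolding One_nat_def sum.atLeast1_atMost_eq .
qed

definition unit_root :: "nat \<Rightarrow> complex" where
  "unit_root N = exp (2 * of_real pi * \<i> / of_nat N)"

lemma norm_unit_root [simp]: "cmod (unit_root N) = 1"
  by (simp add: unit_root_def)

lemma unit_root_power_self: "N > 0 \<Longrightarrow> unit_root N ^ N = 1"
  by (simp add: unit_root_def exp_of_nat_mult[symmetric])

lemma unit_root_power_half: "M > 0 \<Longrightarrow> unit_root (2 * M) ^ M = - 1"
proof -
  assume "M > 0"
  then have "of_nat M * (2 * of_real pi * \<i> / of_nat (2 * M)) = \<i> * of_real pi"
    by simp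
  then show ?thesis
    by (simp only: unit_root_def exp_of_nat_mult[symmetric] exp_pi_i')
qed

lemma unit_root_power_eq_iff:
  assumes "i < N" "j < N"
  shows "unit_root N ^ i = unit_root N ^ j \<longleftrightarrow> i = j"
proof -
  have "unit_root N ^ i = exp (2 * of_real pi * \<i> * of_nat i / of_nat N)" for i
    by (simp add: unit_root_def exp_of_nat_mult[symmetric] mult_ac)
  then show ?thesis
    using complex_root_unity_eq[of N i j] assms by (simp add: cong_def)
qed

lemma unit_mult_cnj: "cmod w = 1 \<Longrightarrow> w * cnj w = 1"
  by (simp add: complex_norm_square[symmetric])

lemma unit_root_orthogonality:
  assumes u: "cmod u = 1" and ij: "i < N" "j < N"
  shows "(\<Sum>k=1..N. cnj (u * unit_root N ^ k) ^ i * (u * unit_root N ^ k) ^ j) = (if i = j then of_nat N else 0)"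
proof -
  define z where "z = unit_root N"
  define v where "v = cnj z ^ i * z ^ j"
  have z: "z * cnj z = 1" unfolding z_def by (intro unit_mult_cnj) simp
  have zN: "z ^ N = 1" unfolding z_def using ij by (intro unit_root_power_self) auto
  have "cnj z ^ N = 1" using zN by (metis complex_cnj_one complex_cnj_power)
  then have vN: "v ^ N = 1"
    using zN by (simp add: v_def power_mult_distrib power_mult[symmetric] mult.commute[of _ N]) (simp add: power_mult)
  have "v = 1 \<longleftrightarrow> z ^ i = z ^ j"
  proof -
    have "z ^ i * v = z ^ j" using z by (simp add: v_def mult.assoc[symmetric] power_mult_distrib[symmetric])
    moreover have "z ^ i \<noteq> 0" using z by auto
    ultimately show ?thesis by (metis mult.right_neutral mult_left_cancel)
  qed
  then have v1: "v = 1 \<longleftrightarrow> i = j" using unit_root_power_eq_iff[OF ij] by (simp add: z_def)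
  have "cnj (u * z ^ k) ^ i * (u * z ^ k) ^ j = cnj u ^ i * u ^ j * v ^ k" for k
    by (simp add: v_def power_mult_distrib mult_ac flip: power_mult)
  then have "(\<Sum>k=1..N. cnj (u * z ^ k) ^ i * (u * z ^ k) ^ j) = cnj u ^ i * u ^ j * (\<Sum>k=1..N. v ^ k)"
    by (simp add: sum_distrib_left)
  also have "\<dots> = (if i = j then of_nat N else 0)"
  proof (cases "i = j")
    case True
    then show ?thesis
      using v1 unit_mult_cnj[OF u] by (simp add: power_mult_distrib[symmetric] mult.commute)
  next
    case False
    then show ?thesis using v1 vN sum_powers_root_of_unity by simp
  qed
  finally show ?thesis unfolding z_def .
qed

text \<open>
  The nodes are the \<open>N\<close> roots of \<open>w ^ N = c N\<close>. Discrete Fourier inversion represents the moments with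
  index below \<open>N\<close>; since both sides are multiplied by \<open>c N\<close> when the index grows by \<open>N\<close>, it represents
  all of them.
\<close>
lemma equally_spaced_quadrature:
  assumes pos: "Toeplitz_positive (herm c)" and c0: "c 0 = 1" and N: "N > 0" "cmod (c N) = 1"
    and u: "u ^ N = c N"
  obtains m :: "nat \<Rightarrow> real"
  where "\<And>k. m k \<ge> 0" "\<And>j. c j = (\<Sum>k=1..N. of_real (m k) * (u * unit_root N ^ k) ^ j)"
proof -
  define w where "w k = u * unit_root N ^ k" for k
  define \<mu> where "\<mu> k = (\<Sum>i<N. c i * cnj (w k) ^ i) / of_nat N" for k
  have u1: "cmod u = 1"
  proof (rule power_eq_imp_eq_base)
    show "cmod u ^ N = 1 ^ N" using u N by (simp add: norm_power[symmetric])
  qed (use N in auto)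
  have wN: "w k ^ N = c N" for k
    using u unit_root_power_self[OF N(1)]
    by (simp add: w_def power_mult_distrib power_mult[symmetric] mult.commute[of _ N]) (simp add: power_mult)
  have \<mu>: "\<mu> k \<in> \<real>\<^sub>\<ge>\<^sub>0" for k
    unfolding \<mu>_def by (rule Fourier_weight_nonneg[OF pos c0 N(2,1) wN])
  have low: "c j = (\<Sum>k=1..N. \<mu> k * w k ^ j)" if j: "j < N" for j
  proof -
    have "(\<Sum>k=1..N. \<mu> k * w k ^ j) = (\<Sum>k=1..N. \<Sum>i<N. c i / of_nat N * (cnj (w k) ^ i * w k ^ j))"
      by (simp add: \<mu>_def sum_divide_distrib sum_distrib_right mult.assoc)
    also have "\<dots> = (\<Sum>i<N. c i / of_nat N * (\<Sum>k=1..N. cnj (w k) ^ i * w k ^ j))"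
      unfolding sum_distrib_left by (rule sum.swap)
    also have "\<dots> = (\<Sum>i<N. c i / of_nat N * (if i = j then of_nat N else 0))"
      using unit_root_orthogonality[OF u1 _ j] by (intro sum.cong refl) (simp add: w_def)
    also have "\<dots> = (\<Sum>i<N. if i = j then c i else 0)"
      using N(1) by (intro sum.cong refl) simp
    also have "\<dots> = c j" using j by simp
    finally show ?thesis by simp
  qed
  have all: "c j = (\<Sum>k=1..N. \<mu> k * w k ^ j)" for j
  proof (induction j rule: less_induct)
    case (less j)
    show ?case
    proof (cases "j < N")
      case False
      define i where "i = j - N"
      have j: "j = i + N" using False by (simp add: i_def)
      have "c j = c N * c i"
        using herm_shift[OF pos c0 N(2), of "int i"] by (simp add: j flip: of_nat_add)
      also have "\<dots> = (\<Sum>k=1..N. \<mu> k * w k ^ j)"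
        using less[of i] N(1) by (simp add: j sum_distrib_left power_add wN mult_ac)
      finally show ?thesis .
    qed (rule low)
  qed
  have "\<mu> k = of_real (Re (\<mu> k))" "Re (\<mu> k) \<ge> 0" for k
    using \<mu>[of k] by (auto simp: complex_nonneg_Reals_iff complex_eq_iff)
  then show ?thesis using all that[of "\<lambda>k. Re (\<mu> k)"] by (simp add: w_def)
qed

lemma sum_even_odd_split:
  fixes h :: "nat \<Rightarrow> 'a::comm_monoid_add"
  shows "(\<Sum>k=1..2*M. h k) = (\<Sum>k=1..M. h (2*k)) + (\<Sum>k=1..M. h (2*k-1))"
  by (induction M) (simp_all add: add_ac)

text \<open>
  The \<open>M\<close>-th power of the nodes alternates in sign, so the \<open>M\<close>-th moment compares the masses of even
  and of odd index.
\<close>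
lemma half_power_moment:
  assumes M: "M > 0"
  shows "(\<Sum>k=1..2*M. of_real (m k) * (u * unit_root (2*M) ^ k) ^ M) =
    u ^ M * of_real ((\<Sum>k=1..M. m (2*k)) - (\<Sum>k=1..M. m (2*k-1)))"
proof -
  have *: "(u * unit_root (2*M) ^ k) ^ M = u ^ M * (- 1) ^ k" for k
    using unit_root_power_half[OF M]
    by (simp add: power_mult_distrib mult.commute[of k M] flip: power_mult) (simp add: power_mult)
  show ?thesis
    unfolding * sum_even_odd_split
    by (simp add: sum_distrib_left right_diff_distrib sum_negf[symmetric] mult_ac)
qed

section \<open>The Fekete-Szego functional on moments\<close>
definition balanced_weights :: "nat \<Rightarrow> (nat \<Rightarrow> real) \<Rightarrow> bool" where
  "balanced_weights M m \<longleftrightarrow> (\<forall>k\<in>{1..2*M}. 0 \<le> m k \<and> m k \<le> 1) \<and>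
     (\<Sum>k=1..M. m (2*k)) = 1/2 \<and> (\<Sum>k=1..M. m (2*k-1)) = 1/2"

text \<open>
  Keeping the term in \<open>\<bar>c M\<bar>\<^sup>2\<close> makes the equality case visible: its coefficient is positive unless
  \<open>\<lambda> = 2\<close>.
\<close>
lemma Fekete_Szego_moments_le:
  assumes pos: "Toeplitz_positive (herm c)" and c0: "c 0 = 1" 
    and lam: "0 < lam" "lam \<le> 2"
  shows "cmod (of_real lam * (c M)\<^sup>2 - c (2 * M)) \<le> 1 - (1 - \<bar>lam - 1\<bar>) * (cmod (c M))\<^sup>2"
proof -
  have "of_real lam * (c M)\<^sup>2 - c (2 * M) = of_real (lam - 1) * (c M)\<^sup>2 - (c (2 * M) - (c M)\<^sup>2)"
    by (simp add: algebra_simps)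
  then have "cmod (of_real lam * (c M)\<^sup>2 - c (2 * M)) \<le> cmod (of_real (lam - 1) * (c M)\<^sup>2) + cmod (c (2 * M) - (c M)\<^sup>2)"
    by (metis norm_triangle_ineq4)
  also have "cmod (of_real (lam - 1) * (c M)\<^sup>2) = \<bar>lam - 1\<bar> * (cmod (c M))\<^sup>2"
    by (simp add: norm_mult norm_power del: of_real_diff)
  also have "\<dots> + cmod (c (2 * M) - (c M)\<^sup>2) \<le> \<dots> + (1 - (cmod (c M))\<^sup>2)"
    using second_moment_bound[OF pos c0] by simp
  finally show ?thesis by (simp add: algebra_simps)
qed

text \<open>
  Equality means \<open>c M = 0\<close> and \<open>\<bar>c (2 * M)\<bar> = 1\<close>: the first is the balance of the masses, the second
  confines them to equally spaced nodes.
\<close>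
lemma Fekete_Szego_moments_eq_iff:
  assumes pos: "Toeplitz_positive (herm c)" and c0: "c 0 = 1" 
    and lam: "0 < lam" "lam < 2" and M: "M > 0"
  shows "cmod (of_real lam * (c M)\<^sup>2 - c (2 * M)) = 1 \<longleftrightarrow>
    (\<exists>u m. cmod u = 1 \<and> balanced_weights M m \<and>
       (\<forall>j. c j = (\<Sum>k=1..2*M. of_real (m k) * (u * unit_root (2*M) ^ k) ^ j)))"
proof
  assume eq: "cmod (of_real lam * (c M)\<^sup>2 - c (2 * M)) = 1"
  have "(1 - \<bar>lam - 1\<bar>) * (cmod (c M))\<^sup>2 \<le> 0"
    using Fekete_Szego_moments_le[OF pos c0, of lam M] lam eq by simp
  moreover have "1 - \<bar>lam - 1\<bar> > 0" using lam by (simp add: abs_if)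
  ultimately have cM: "c M = 0" by (simp add: mult_le_0_iff)
  then have cN: "cmod (c (2 * M)) = 1" using eq by simp
  define u where "u = exp (\<i> * of_real (Arg (c (2 * M)) / real (2 * M)))"
  have u1: "cmod u = 1" unfolding u_def by (simp del: of_real_divide of_nat_mult)
  have "u ^ (2 * M) = exp (\<i> * of_real (Arg (c (2 * M))))"
    unfolding u_def exp_of_nat_mult[symmetric] using M by simp
  also have "\<dots> = c (2 * M)"
    using Arg_eq[of "c (2 * M)"] cN by (metis mult_1 norm_zero of_real_1 zero_neq_one)
  finally have uN: "u ^ (2 * M) = c (2 * M)" .
  obtain m where m: "\<And>k. m k \<ge> 0"
    "\<And>j. c j = (\<Sum>k=1..2*M. of_real (m k) * (u * unit_root (2*M) ^ k) ^ j)"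
    using equally_spaced_quadrature[OF pos c0 _ cN uN] M by auto
  have "u ^ M * of_real ((\<Sum>k=1..M. m (2*k)) - (\<Sum>k=1..M. m (2*k-1))) = 0"
    using m(2)[of M] cM unfolding half_power_moment[OF M] by simp
  moreover have "u \<noteq> 0" using u1 by auto
  ultimately have EO: "(\<Sum>k=1..M. m (2*k)) = (\<Sum>k=1..M. m (2*k-1))"
    by (simp del: of_real_diff of_real_sum)
  have "complex_of_real (\<Sum>k=1..2*M. m k) = 1" using m(2)[of 0] c0 by simp
  then have tot: "(\<Sum>k=1..2*M. m k) = 1" by (simp only: of_real_eq_1_iff)
  have "m k \<le> 1" if "k \<in> {1..2*M}" for k
    using member_le_sum[of k "{1..2*M}" m] that m(1) tot by simp
  then have "balanced_weights M m"
    using m(1) EO tot unfolding sum_even_odd_split balanced_weights_def by auto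
  with u1 m(2) show "\<exists>u m. cmod u = 1 \<and> balanced_weights M m \<and>
       (\<forall>j. c j = (\<Sum>k=1..2*M. of_real (m k) * (u * unit_root (2*M) ^ k) ^ j))"
    by blast
next
  assume "\<exists>u m. cmod u = 1 \<and> balanced_weights M m \<and>
       (\<forall>j. c j = (\<Sum>k=1..2*M. of_real (m k) * (u * unit_root (2*M) ^ k) ^ j))"
  then obtain u m where u: "cmod u = 1" and m: "balanced_weights M m"
    and c: "\<And>j. c j = (\<Sum>k=1..2*M. of_real (m k) * (u * unit_root (2*M) ^ k) ^ j)" by blast
  have "(\<Sum>k=1..M. m (2*k)) - (\<Sum>k=1..M. m (2*k-1)) = 0"
    using m by (simp add: balanced_weights_def)
  then have "c M = 0"
    unfolding c[of M] half_power_moment[OF M] by (simp only: of_real_0 mult_zero_right)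
  moreover have "c (2 * M) = u ^ (2 * M)"
  proof -
    have *: "(u * unit_root (2*M) ^ k) ^ (2 * M) = u ^ (2 * M)" for k
      using unit_root_power_self[of "2 * M"] M
      by (simp add: power_mult_distrib mult.commute[of k] flip: power_mult) (simp add: power_mult)
    have "c (2 * M) = of_real (\<Sum>k=1..2*M. m k) * u ^ (2 * M)"
      unfolding c[of "2 * M"] * by (simp add: sum_distrib_right)
    also have "(\<Sum>k=1..2*M. m k) = 1"
      unfolding sum_even_odd_split using m by (simp add: balanced_weights_def)
    finally show ?thesis by simp
  qed
  ultimately show "cmod (of_real lam * (c M)\<^sup>2 - c (2 * M)) = 1"
    using u by (simp add: norm_power)
qed

section \<open>From moments to functions\<close>
lemma sums_partial_fractions:
  assumes w: "\<And>k. k \<in> K \<Longrightarrow> cmod (w k) = 1" and z: "cmod z < 1"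
  shows "(\<lambda>j. (\<Sum>k\<in>K. \<mu> k * w k ^ j) * z ^ j) sums (\<Sum>k\<in>K. \<mu> k / (1 - w k * z))"
proof -
  have "(\<lambda>j. \<Sum>k\<in>K. \<mu> k * (w k * z) ^ j) sums (\<Sum>k\<in>K. \<mu> k * (1 / (1 - w k * z)))"
    using w z by (intro sums_sum sums_mult geometric_sums) (simp add: norm_mult)
  then show ?thesis by (simp add: sum_distrib_right power_mult_distrib mult.assoc)
qed

lemma power_series_unique:
  fixes b c :: "nat \<Rightarrow> complex"
  assumes "\<And>z. cmod z < 1 \<Longrightarrow> (\<lambda>k. b k * z ^ k) sums F z"
    and "\<And>z. cmod z < 1 \<Longrightarrow> (\<lambda>k. c k * z ^ k) sums F z"
  shows "b = c"
proof -
  have "F has_fps_expansion Abs_fps e" if "\<And>z. cmod z < 1 \<Longrightarrow> (\<lambda>k. e k * z ^ k) sums F z" for e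
    using that by (intro has_fps_expansionI eventually_nhds_in_open[of "ball 0 1", THEN eventually_mono]) auto
  then have "Abs_fps b = Abs_fps c"
    using assms fps_expansion_unique_complex by blast
  then show ?thesis by (simp add: fps_eq_iff fun_eq_iff)
qed

text \<open>
  The nodes \<open>exp (i \<theta>\<^sub>k)\<close> of the extremal functions are the \<open>(2 n - 2)\<close>-th roots of \<open>-1\<close>, that is, the
  corresponding roots of unity turned by \<open>\<pi> / (2 n - 2)\<close>.
\<close>
lemma extremal_exp_eq:
  assumes "n \<ge> 2"
  shows "exp (\<i> * of_real (extremal_angle n k)) =
    exp (\<i> * of_real (pi / real (2 * (n - 1)))) * unit_root (2 * (n - 1)) ^ k"
proof -
  have "extremal_angle n k = pi / real (2 * (n - 1)) + real k * (2 * pi / real (2 * (n - 1)))"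
    using assms by (simp add: extremal_angle_def of_nat_diff divide_simps) (simp add: algebra_simps)
  then have "\<i> * of_real (extremal_angle n k) = \<i> * of_real (pi / real (2 * (n - 1))) +
      of_nat k * (2 * of_real pi * \<i> / of_nat (2 * (n - 1)))"
    by (simp add: algebra_simps)
  then show ?thesis
    by (simp only: exp_add exp_of_nat_mult unit_root_def)
qed

text \<open>
  Rotating an extremal function by \<open>v\<close> multiplies its nodes by \<open>v\<close>, so after division by \<open>z\<close> the rotated
  extremal functions are the partial fraction sums with balanced weights over arbitrary systems of
  \<open>2 n - 2\<close> equally spaced nodes; expanding in geometric series translates this into moments.
\<close>
lemma rotated_extremal_iff:
  assumes n: "n \<ge> 2" and F: "\<And>z. cmod z < 1 \<Longrightarrow> (\<lambda>k. c k * z ^ k) sums F z"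
    and f: "\<And>z. cmod z < 1 \<Longrightarrow> f z = z * F z" and c0: "c 0 = 1"
  shows "(\<exists>g\<in>extremal_functions n. \<exists>v. cmod v = 1 \<and> (\<forall>z\<in>ball 0 1. f z = rotation v g z)) \<longleftrightarrow>
    (\<exists>u m. cmod u = 1 \<and> balanced_weights (n - 1) m \<and>
       (\<forall>j. c j = (\<Sum>k=1..2*(n-1). of_real (m k) * (u * unit_root (2*(n-1)) ^ k) ^ j)))"
proof -
  define M where "M = n - 1"
  have NM: "2 * n - 2 = 2 * M" by (simp add: M_def)
  define \<alpha> where "\<alpha> = exp (\<i> * of_real (pi / real (2 * M)))"
  have \<alpha>: "cmod \<alpha> = 1" by (simp add: \<alpha>_def del: of_real_divide)
  define G where "G m z = (\<Sum>k=1..2*M. of_real (m k) * (z / (1 - exp (\<i> * of_real (extremal_angle n k)) * z)))"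
    for m :: "nat \<Rightarrow> real" and z
  define H where "H u m z = (\<Sum>k=1..2*M. of_real (m k) / (1 - (u * unit_root (2*M) ^ k) * z))"
    for u and m :: "nat \<Rightarrow> real" and z
  have ext: "extremal_functions n = {G m | m. balanced_weights M m}"
    unfolding extremal_functions_def balanced_weights_def G_def[abs_def] NM M_def by simp
  have rot: "rotation v (G m) z = z * H (v * \<alpha>) m z" if "cmod v = 1" for v m z
  proof -
    have "cnj v * (of_real (m k) * (v * z / (1 - exp (\<i> * of_real (extremal_angle n k)) * (v * z)))) =
      z * (of_real (m k) / (1 - (v * \<alpha> * unit_root (2 * M) ^ k) * z))" for k
      using unit_mult_cnj[OF that]
      unfolding extremal_exp_eq[OF n] M_def[symmetric] \<alpha>_def[symmetric] by (simp add: mult_ac)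
    then show ?thesis
      unfolding rotation_def G_def H_def sum_distrib_left by simp
  qed
  have H_sums: "(\<lambda>j. (\<Sum>k=1..2*M. of_real (m k) * (u * unit_root (2*M) ^ k) ^ j) * z ^ j) sums H u m z"
    if "cmod u = 1" "cmod z < 1" for u m z
    unfolding H_def using that by (intro sums_partial_fractions) (simp_all add: norm_mult norm_power)
  have coeff: "(\<forall>z\<in>ball 0 1. f z = z * H u m z) \<longleftrightarrow>
      (\<forall>j. c j = (\<Sum>k=1..2*M. of_real (m k) * (u * unit_root (2*M) ^ k) ^ j))"
    if u: "cmod u = 1" and m: "balanced_weights M m" for u m
  proof
    assume eq: "\<forall>z\<in>ball 0 1. f z = z * H u m z"
    have "H u m z = F z" if z: "cmod z < 1" for z
    proof (cases "z = 0")
      case True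
      have "H u m 0 = of_real (\<Sum>k=1..2*M. m k)" by (simp add: H_def)
      also have "(\<Sum>k=1..2*M. m k) = 1"
        unfolding sum_even_odd_split using m by (simp add: balanced_weights_def)
      finally have "H u m 0 = 1" by simp
      moreover have "F 0 = 1"
        using sums_unique2[OF F[of 0] powser_sums_zero[of c]] c0 by simp
      ultimately show ?thesis using True by simp
    next
      case False
      then show ?thesis using eq f[OF z] z by auto
    qed
    then have "c = (\<lambda>j. \<Sum>k=1..2*M. of_real (m k) * (u * unit_root (2*M) ^ k) ^ j)"
      using F H_sums[OF u, of _ m] by (intro power_series_unique[of _ F]) auto
    then show "\<forall>j. c j = (\<Sum>k=1..2*M. of_real (m k) * (u * unit_root (2*M) ^ k) ^ j)"
      by (metis (no_types))
  next
    assume "\<forall>j. c j = (\<Sum>k=1..2*M. of_real (m k) * (u * unit_root (2*M) ^ k) ^ j)"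
    then have "F z = H u m z" if "cmod z < 1" for z
      using sums_unique2[OF F[OF that]] H_sums[OF u that, of m] by simp
    then show "\<forall>z\<in>ball 0 1. f z = z * H u m z" using f by simp
  qed
  have "(\<exists>g\<in>extremal_functions n. \<exists>v. cmod v = 1 \<and> (\<forall>z\<in>ball 0 1. f z = rotation v g z)) \<longleftrightarrow>
      (\<exists>v m. cmod v = 1 \<and> balanced_weights M m \<and> (\<forall>z\<in>ball 0 1. f z = rotation v (G m) z))"
    unfolding ext by blast
  also have "\<dots> \<longleftrightarrow> (\<exists>v m. cmod v = 1 \<and> balanced_weights M m \<and> (\<forall>z\<in>ball 0 1. f z = z * H (v * \<alpha>) m z))"
    using rot by metis
  also have "\<dots> \<longleftrightarrow> (\<exists>u m. cmod u = 1 \<and> balanced_weights M m \<and> (\<forall>z\<in>ball 0 1. f z = z * H u m z))"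
  proof safe
    fix v m assume "cmod v = 1" "balanced_weights M m" "\<forall>z\<in>ball 0 1. f z = z * H (v * \<alpha>) m z"
    then show "\<exists>u m. cmod u = 1 \<and> balanced_weights M m \<and> (\<forall>z\<in>ball 0 1. f z = z * H u m z)"
      using \<alpha> by (intro exI[of _ "v * \<alpha>"] exI[of _ m]) (simp add: norm_mult)
  next
    fix u m assume "cmod u = 1" "balanced_weights M m" "\<forall>z\<in>ball 0 1. f z = z * H u m z"
    moreover have "u / \<alpha> * \<alpha> = u" using \<alpha> by auto
    ultimately show "\<exists>v m. cmod v = 1 \<and> balanced_weights M m \<and> (\<forall>z\<in>ball 0 1. f z = z * H (v * \<alpha>) m z)"
      using \<alpha> by (intro exI[of _ "u / \<alpha>"] exI[of _ m]) (simp add: norm_divide)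
  qed
  also have "\<dots> \<longleftrightarrow> (\<exists>u m. cmod u = 1 \<and> balanced_weights M m \<and>
      (\<forall>j. c j = (\<Sum>k=1..2*M. of_real (m k) * (u * unit_root (2*M) ^ k) ^ j)))"
    by (intro ex_cong1 conj_cong refl coeff)
  finally show ?thesis unfolding M_def .
qed

theorem theorem3:
  fixes lam :: real and f :: "complex \<Rightarrow> complex" and a :: "nat \<Rightarrow> complex"
  assumes "0 < lam" and "lam \<le> 2"
    and "f \<in> compact_convergence (ball 0 1) closure_of (convex hull class_C)"
    and "\<And>z. z \<in> ball 0 1 \<Longrightarrow> (\<lambda>n. a (n + 2) * z ^ (n + 2)) sums (f z - z)"
  shows "(\<forall>n\<ge>2. cmod (lam * (a n)\<^sup>2 - a (2 * n - 1)) \<le> 1) \<and>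
    (\<forall>n\<ge>2. lam < 2 \<longrightarrow>
       (cmod (lam * (a n)\<^sup>2 - a (2 * n - 1)) = 1 \<longleftrightarrow>
         (\<exists>g\<in>extremal_functions n. \<exists>c. cmod c = 1 \<and>
            (\<forall>z\<in>ball 0 1. f z = rotation c g z))))"
proof -
  define c where "c j = (if j = 0 then 1 else a (Suc j))" for j
  define F where "F z = (if z = 0 then 1 else f z / z)" for z
  have c0: "c 0 = 1" by (simp add: c_def)
  have f0: "f 0 = 0"
    using assms(4)[of 0] sums_unique2[OF _ sums_zero] by fastforce
  then have f: "f z = z * F z" for z by (simp add: F_def)
  have F: "(\<lambda>j. c j * z ^ j) sums F z" if z: "cmod z < 1" for z
  proof (cases "z = 0")
    case True
    then show ?thesis using powser_sums_zero[of c] c0 by (simp add: F_def)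
  next
    case False
    have "(\<lambda>n. a (n + 2) * z ^ (n + 2) / z) sums ((f z - z) / z)"
      using assms(4)[of z] z by (intro sums_divide) simp
    moreover have "a (n + 2) * z ^ (n + 2) / z = c (Suc n) * z ^ Suc n" for n
      using False by (simp add: c_def)
    moreover have "(f z - z) / z = F z - c 0 * z ^ 0"
      using False by (simp add: F_def c_def diff_divide_distrib)
    ultimately show ?thesis using sums_Suc_iff[of "\<lambda>j. c j * z ^ j"] by simp
  qed
  have "Re (F z) \<ge> 1 / 2" if z: "cmod z < 1" for z
  proof (cases "z = 0")
    case False
    have "(cmod z)\<^sup>2 / 2 \<le> Re (cnj z * f z)"
      by (rule closure_hull_class_C_Re[OF assms(3) z])
    also have "cnj z * f z = of_real ((cmod z)\<^sup>2) * F z"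
      unfolding f complex_norm_square by simp
    finally have "(cmod z)\<^sup>2 * (1 / 2) \<le> (cmod z)\<^sup>2 * Re (F z)" by (simp del: of_real_power)
    then show ?thesis using False by (subst (asm) mult_le_cancel_left_pos) auto
  qed (simp add: F_def)
  then have pos: "Toeplitz_positive (herm c)"
    using F c0 by (intro Toeplitz_positive_of_Re_ge_half)
  have coeff: "a n = c (n - 1)" "a (2 * n - 1) = c (2 * (n - 1))" if "n \<ge> 2" for n
    using that by (auto simp: c_def Suc_diff_Suc numeral_2_eq_2)
  have le: "cmod (lam * (a n)\<^sup>2 - a (2 * n - 1)) \<le> 1" if n: "n \<ge> 2" for n
  proof -
    have "(1 - \<bar>lam - 1\<bar>) * (cmod (c (n - 1)))\<^sup>2 \<ge> 0" using assms(1,2) by (intro mult_nonneg_nonneg) auto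
    then show ?thesis
      using Fekete_Szego_moments_le[OF pos c0 assms(1,2), of "n - 1"] unfolding coeff[OF n] by linarith
  qed
  have "cmod (lam * (a n)\<^sup>2 - a (2 * n - 1)) = 1 \<longleftrightarrow>
         (\<exists>g\<in>extremal_functions n. \<exists>c. cmod c = 1 \<and> (\<forall>z\<in>ball 0 1. f z = rotation c g z))"
    if n: "n \<ge> 2" and lam: "lam < 2" for n
    unfolding coeff[OF n]
  proof (rule trans[OF Fekete_Szego_moments_eq_iff rotated_extremal_iff[symmetric]])
    show "n - 1 > 0" using n by simp
  qed (use n lam F f c0 pos assms(1) in auto)
  with le show ?thesis by blast
qed

end
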